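(* For any $c>\frac12$, $$\mathrm{Prob}\bigl(\sigma_{\{T_j\}}\leq c\bigr)=\frac12+\frac{2c}{\pi}\int_0^\infty \Im\left(\frac{e^{(\frac{\pi}{4c}-y)i}}{\gamma(-\frac1{2c},-iy)}\right)y^{-1-\frac1{2c}}\,dy,$$ and the integral on the right-hand side is absolutely convergent.
   Context: Let $0<T_1<T_2<\cdots$ be the points of a Poisson process on the positive real line with constant intensity $\frac12$. Almost surely there is a unique $\sigma>\frac12$ with $T_1^{-2\sigma}=\sum_{j=2}^\infty T_j^{-2\sigma}$; $\sigma_{\{T_j\}}$ denotes this random variable. The lower incomplete gamma function is $\gamma(s,z):=\int_0^z u^{s-1}e^{-u}\,du$ for $\Re s>0$ and $z\in\mathbb{C}\setminus\mathbb{R}_{<0}$, where the path of integration stays inside this cut plane and $|\arg u|<\pi$ for $u\in\mathbb{C}\setminus\mathbb{R}_{\le0}$. It is extended to all $s\in\mathbb{C}\setminus\mathbb{Z}_{\le0}$ (with $z\in\mathbb{C}\setminus\mathbb{R}_{<0}$) through the recursion $\gamma(s,z)=\dfrac{\gamma(s+1,z)+z^se^{-z}}{s}$. *)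

theory Defs
  imports "HOL-Probability.Probability" "HOL-Complex_Analysis.Complex_Analysis"
begin

section \<open>Poisson processes on the positive half-line\<close>

text \<open>
  The points of a realisation are \<open>T 1 \<omega> < T 2 \<omega> < \<dots>\<close>; the value of \<open>T\<close> at index 0 is never used.
\<close>

definition point_count :: "(nat \<Rightarrow> real) \<Rightarrow> real set \<Rightarrow> nat" where
  "point_count t B = card {j. 1 \<le> j \<and> t j \<in> B}"

definition bounded_borel_pos :: "real set set" where
  "bounded_borel_pos = {B \<in> sets borel. bounded B \<and> B \<subseteq> {0<..}}"

text \<open>
  The Poisson law of the counts is written out by its weights, as \<open>poisson_pmf\<close> is only meaningful for
  a positive rate, whereas \<open>B\<close> may be a null set. The clause \<open>locally_finite\<close> makes
  \<open>point_count\<close> (a \<open>card\<close>) the true number of points almost surely.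
\<close>

locale poisson_process = prob_space M for M :: "'a measure" +
  fixes r :: real and T :: "nat \<Rightarrow> 'a \<Rightarrow> real"
  assumes intensity_pos: "r > 0"
    and measurable_points: "\<And>j. 1 \<le> j \<Longrightarrow> random_variable borel (T j)"
    and points_pos: "\<And>\<omega>. \<omega> \<in> space M \<Longrightarrow> 0 < T 1 \<omega>"
    and points_increasing: "\<And>\<omega> j. \<omega> \<in> space M \<Longrightarrow> 1 \<le> j \<Longrightarrow> T j \<omega> < T (Suc j) \<omega>"
    and locally_finite:
      "\<And>B. B \<in> bounded_borel_pos \<Longrightarrow> AE \<omega> in M. finite {j. 1 \<le> j \<and> T j \<omega> \<in> B}"
    and poisson_counts:
      "\<And>B n. B \<in> bounded_borel_pos \<Longrightarrow>
        prob {\<omega> \<in> space M. point_count (\<lambda>j. T j \<omega>) B = n} =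
          (r * measure lborel B) ^ n / fact n * exp (- (r * measure lborel B))"
    and indep_counts:
      "\<And>(I :: nat set) B. finite I \<Longrightarrow> (\<And>i. i \<in> I \<Longrightarrow> B i \<in> bounded_borel_pos) \<Longrightarrow>
        disjoint_family_on B I \<Longrightarrow>
        indep_vars (\<lambda>_. count_space UNIV) (\<lambda>i \<omega>. point_count (\<lambda>j. T j \<omega>) (B i)) I"

section \<open>The balancing exponent of a sequence of points\<close>

definition is_balance_exponent :: "(nat \<Rightarrow> real) \<Rightarrow> real \<Rightarrow> bool" where
  "is_balance_exponent t \<sigma> \<longleftrightarrow>
     \<sigma> > 1 / 2 \<and> ((\<lambda>j. t j powr (- 2 * \<sigma>)) has_sum t 1 powr (- 2 * \<sigma>)) {2..}"

text \<open>
  Unique existence holds only almost surely. For strictly increasing positive sequences uniqueness is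
  automatic, so where it fails there is no exponent, and the definite description then is one
  fixed unspecified real.
\<close>

definition balance_exponent :: "(nat \<Rightarrow> real) \<Rightarrow> real" where
  "balance_exponent t = (THE \<sigma>. is_balance_exponent t \<sigma>)"

section \<open>The lower incomplete gamma function\<close>

text \<open>
  For \<open>Re s > 0\<close> the integral is taken along the straight segment from 0 to \<open>z\<close>, which stays in the
  cut plane (the integral does not depend on the path there), and \<open>powr\<close> is the principal branch.
  Off the domain, i.e. at the poles \<open>s = 0, -1, -2, \<dots>\<close> and for \<open>z\<close> on the negative real axis,
  the value carries no meaning.
\<close>

function lower_gamma :: "complex \<Rightarrow> complex \<Rightarrow> complex" where
  "lower_gamma s z =
     (if Re s > 0 then contour_integral (linepath 0 z) (\<lambda>u. u powr (s - 1) * exp (- u))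
      else (lower_gamma (s + 1) z + z powr s * exp (- z)) / s)"
  by pat_completeness auto
termination
  by (relation "Wellfounded.measure (\<lambda>(s, z). nat \<lceil>1 - Re s\<rceil>)") (auto, linarith)

text \<open>The unconditional equation would loop as a rewrite rule.\<close>

declare lower_gamma.simps [simp del]

end

theory Submission
  imports Defs "HOL-Real_Asymp.Real_Asymp"
begin

text \<open>
  Put \<open>b = 2 c\<close> and let \<open>gap b\<close> be the sum of \<open>T j powr - b\<close> over \<open>j \<ge> 2\<close> minus \<open>T 1 powr - b\<close>.
  Since the sum of \<open>(T j / T 1) powr - (2 \<sigma>)\<close> over \<open>j \<ge> 2\<close> is strictly decreasing in \<open>\<sigma>\<close>, the
  exponent is at most \<open>c\<close> iff \<open>gap b \<le> 0\<close>. Conditioning on the first point and using the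
  characteristic functional of the remaining points gives the characteristic function \<open>\<phi>\<close> of \<open>gap b\<close>.
  After rescaling, for rate \<open>r\<close>, it is \<open>\<phi> (s powr b) = r s \<integral> exp (r s G(v) - i v powr - b) dv\<close>,
  where \<open>G(v)\<close> is \<open>- v\<close> plus the integral of \<open>exp (i u powr - b) - 1\<close> over \<open>u > v\<close>. In the inversion
  formula for the probability of \<open>gap b \<le> 0\<close> the integral over \<open>s\<close> is elementary and leaves
  \<open>\<integral> Im (exp (- i v powr - b) / G(v)) dv\<close>. The substitution \<open>v = y powr (- 1 / b)\<close> turns \<open>G(v)\<close> into
  the incomplete gamma function at \<open>- i y\<close>, by an integration by parts.
\<close>

section \<open>Poisson processes\<close>

text \<open>The obstacle is the order of integration in the inversion. The integrand in
  \<open>s\<close> and \<open>v\<close> is not absolutely integrable: the \<open>v\<close>-integral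
  of its modulus is of order \<open>1 / s\<close> at \<open>s = 0\<close>. Only its imaginary part
  is, because for large \<open>v\<close> the integrand is nearly real. The same estimate yields the
  absolute convergence claimed in the theorem. Inversion produces the expectation of
  \<open>sgn (gap b)\<close>, so the probability also needs that \<open>gap b\<close> has no atom at
  \<open>0\<close>; this follows from the decay of its characteristic function. Independence is
  given only for the counts of finitely many fixed disjoint sets. Hence the characteristic
  functional and the conditioning on the random first point are both reached by discretisation and a
  limit. Finally, the exponent exists only almost surely and \<open>M\<close> may be incomplete, so
  measurability of the event \<open>balance_exponent <= c\<close> is a task of its own.\<close>

lemma (in prob_space) expectation_nat_sums:
  fixes X :: "'a \<Rightarrow> nat" and f :: "nat \<Rightarrow> 'b :: {banach, second_countable_topology}"
  assumes X[measurable]: "X \<in> measurable M (count_space UNIV)"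
    and summ: "summable (\<lambda>n. prob {\<omega> \<in> space M. X \<omega> = n} * norm (f n))"
  shows "integrable M (\<lambda>\<omega>. f (X \<omega>))"
    and "(\<lambda>n. prob {\<omega> \<in> space M. X \<omega> = n} *\<^sub>R f n) sums expectation (\<lambda>\<omega>. f (X \<omega>))"
proof -
  define p where "p n = prob {\<omega> \<in> space M. X \<omega> = n}" for n
  have D: "distr M (count_space UNIV) X = density (count_space UNIV) (\<lambda>n. ennreal (p n))"
  proof (rule measure_eqI_countable[where A=UNIV])
    fix n :: nat
    have "X -` {n} \<inter> space M = {\<omega> \<in> space M. X \<omega> = n}" by auto
    then show "emeasure (distr M (count_space UNIV) X) {n}
        = emeasure (density (count_space UNIV) (\<lambda>n. ennreal (p n))) {n}"
      by (simp add: emeasure_distr emeasure_density emeasure_eq_measure p_def nn_integral_cmult_indicator)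
  qed auto
  have int: "integrable (count_space UNIV) (\<lambda>n. p n *\<^sub>R f n)"
    using summ by (simp add: integrable_count_space_nat_iff p_def)
  have "integrable (density (count_space UNIV) (\<lambda>n. ennreal (p n))) f"
    using int by (subst integrable_density) (auto simp: p_def)
  then have "integrable (distr M (count_space UNIV) X) f" by (simp add: D)
  then show "integrable M (\<lambda>\<omega>. f (X \<omega>))"
    by (subst (asm) integrable_distr_eq) auto
  have "expectation (\<lambda>\<omega>. f (X \<omega>)) = integral\<^sup>L (distr M (count_space UNIV) X) f"
    by (subst integral_distr) auto
  also have "\<dots> = integral\<^sup>L (count_space UNIV) (\<lambda>n. p n *\<^sub>R f n)"
    unfolding D by (subst integral_density) (auto simp: p_def)
  finally show "(\<lambda>n. prob {\<omega> \<in> space M. X \<omega> = n} *\<^sub>R f n) sums expectation (\<lambda>\<omega>. f (X \<omega>))"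
    using sums_integral_count_space_nat[OF int] by (simp add: p_def)
qed

context poisson_process
begin

abbreviation N :: "real set \<Rightarrow> 'a \<Rightarrow> nat" where
  "N B \<omega> \<equiv> point_count (\<lambda>j. T j \<omega>) B"

lemma interval_bounded_borel_pos: "0 \<le> a \<Longrightarrow> {a<..b} \<in> bounded_borel_pos"
  by (auto simp: bounded_borel_pos_def intro!: bounded_subset[OF bounded_closed_interval[of a b]])

lemma measurable_count [measurable]:
  assumes "B \<in> bounded_borel_pos"
  shows "N B \<in> measurable M (count_space UNIV)"
  using indep_counts[of "{0}" "\<lambda>_. B"] assms by (auto simp: indep_vars_def disjoint_family_on_def)

text \<open>The Poisson generating series is entire, so every \<open>z\<close> is admissible. The
  field stays generic because the Chernoff bounds take real \<open>z\<close>, whereas the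
  characteristic functional takes complex \<open>z\<close>: points of the unit circle, and
  \<open>0\<close>.\<close>

lemma count_generating_function:
  fixes z :: "'b :: {real_normed_field, banach, second_countable_topology}"
  assumes B: "B \<in> bounded_borel_pos"
  shows "integrable M (\<lambda>\<omega>. z ^ N B \<omega>)"
    and "expectation (\<lambda>\<omega>. z ^ N B \<omega>) = exp (of_real (r * measure lborel B) * (z - 1))"
proof -
  define m where "m = r * measure lborel B"
  have p: "prob {\<omega> \<in> space M. N B \<omega> = n} = m ^ n / fact n * exp (- m)" for n
    using poisson_counts[OF B] by (simp add: m_def)
  have m0: "m \<ge> 0" using intensity_pos by (simp add: m_def)
  have "summable (\<lambda>n. exp (- m) * ((m * norm z) ^ n /\<^sub>R fact n))"
    by (intro summable_mult summable_exp_generic)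
  also have "(\<lambda>n. exp (- m) * ((m * norm z) ^ n /\<^sub>R fact n))
     = (\<lambda>n. prob {\<omega> \<in> space M. N B \<omega> = n} * norm (z ^ n))"
    by (simp add: p power_mult_distrib norm_power divide_inverse mult_ac fun_eq_iff)
  finally have s: "summable (\<lambda>n. prob {\<omega> \<in> space M. N B \<omega> = n} * norm (z ^ n))" .
  show "integrable M (\<lambda>\<omega>. z ^ N B \<omega>)"
    by (rule expectation_nat_sums(1)[OF measurable_count[OF B] s])
  have 1: "(\<lambda>n. prob {\<omega> \<in> space M. N B \<omega> = n} *\<^sub>R z ^ n) sums expectation (\<lambda>\<omega>. z ^ N B \<omega>)"
    by (rule expectation_nat_sums(2)[OF measurable_count[OF B] s])
  have "(\<lambda>n. of_real (exp (- m)) * ((of_real m * z) ^ n /\<^sub>R fact n))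
      sums (of_real (exp (- m)) * exp (of_real m * z))"
    by (intro sums_mult exp_converges)
  also have "(\<lambda>n. of_real (exp (- m)) * ((of_real m * z) ^ n /\<^sub>R fact n))
     = (\<lambda>n. prob {\<omega> \<in> space M. N B \<omega> = n} *\<^sub>R z ^ n)"
    by (simp add: p power_mult_distrib scaleR_conv_of_real divide_inverse mult_ac fun_eq_iff)
  also have "of_real (exp (- m)) * exp (of_real m * z) = exp (of_real m * (z - 1))"
    by (simp add: exp_of_real[symmetric] mult_exp_exp algebra_simps)
  finally show "expectation (\<lambda>\<omega>. z ^ N B \<omega>) = exp (of_real (r * measure lborel B) * (z - 1))"
    using sums_unique2[OF 1] by (simp add: m_def)
qed

lemma joint_generating_function:
  fixes z :: "nat \<Rightarrow> complex"
  assumes I: "finite I" "\<And>i. i \<in> I \<Longrightarrow> B i \<in> bounded_borel_pos" "disjoint_family_on B I"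
  shows "expectation (\<lambda>\<omega>. \<Prod>i\<in>I. z i ^ N (B i) \<omega>)
      = exp (of_real r * (\<Sum>i\<in>I. of_real (measure lborel (B i)) * (z i - 1)))"
proof -
  have "indep_vars (\<lambda>_. borel) (\<lambda>i \<omega>. z i ^ N (B i) \<omega>) I"
    using indep_vars_compose2[OF indep_counts[OF I], of "\<lambda>i n. z i ^ n" "\<lambda>_. borel"] by auto
  then have "expectation (\<lambda>\<omega>. \<Prod>i\<in>I. z i ^ N (B i) \<omega>)
      = (\<Prod>i\<in>I. expectation (\<lambda>\<omega>. z i ^ N (B i) \<omega>))"
    using I count_generating_function(1) by (intro indep_vars_lebesgue_integral) auto
  also have "\<dots> = (\<Prod>i\<in>I. exp (of_real (r * measure lborel (B i)) * (z i - 1)))"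
    using I count_generating_function(2) by (intro prod.cong) auto
  finally show ?thesis
    using I(1) by (simp add: exp_sum sum_distrib_left mult_ac)
qed

section \<open>Points versus counts, and the law of the first point\<close>

lemma points_less:
  assumes "\<omega> \<in> space M" "1 \<le> i" "i < j"
  shows "T i \<omega> < T j \<omega>"
  using assms(3,2)
proof (induction rule: strict_inc_induct)
  case (base i) then show ?case using points_increasing[OF assms(1), of i] by simp
next
  case (step i) then show ?case using points_increasing[OF assms(1), of i] by simp
qed

lemma points_mono:
  assumes "\<omega> \<in> space M" "1 \<le> i" "i \<le> j"
  shows "T i \<omega> \<le> T j \<omega>"
  using points_less[OF assms(1,2), of j] assms(3) by (cases "i = j") auto

lemma point_pos:
  assumes "\<omega> \<in> space M" "1 \<le> j"
  shows "0 < T j \<omega>"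
  using points_mono[OF assms(1), of 1 j] points_pos[OF assms(1)] assms(2) by linarith

lemma count_le_imp:
  assumes "\<omega> \<in> space M" "1 \<le> n" "N {0<..x} \<omega> \<ge> n"
  shows "T n \<omega> \<le> x"
proof (rule ccontr)
  assume "\<not> T n \<omega> \<le> x"
  then have "{j. 1 \<le> j \<and> T j \<omega> \<in> {0<..x}} \<subseteq> {1..<n}"
    using points_mono[OF assms(1), of n] assms(2)
    by auto (metis le_less_linear order_trans)
  then have "N {0<..x} \<omega> \<le> card {1..<n}"
    unfolding point_count_def by (intro card_mono) auto
  then show False using assms by auto
qed

text \<open>Finiteness enters because \<open>point_count\<close> is a \<open>card\<close>, which
  would be \<open>0\<close> on an infinite index set.\<close>

lemma count_ge_if:
  assumes "\<omega> \<in> space M" "1 \<le> n" "finite {j. 1 \<le> j \<and> T j \<omega> \<in> {0<..x}}" "T n \<omega> \<le> x"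
  shows "N {0<..x} \<omega> \<ge> n"
proof -
  have "{1..n} \<subseteq> {j. 1 \<le> j \<and> T j \<omega> \<in> {0<..x}}"
    using points_mono[OF assms(1), of _ n] point_pos[OF assms(1)] assms(4) by force
  then have "card {1..n} \<le> N {0<..x} \<omega>"
    unfolding point_count_def using assms(3) by (intro card_mono)
  then show ?thesis by simp
qed

text \<open>Intervals with integer end points exhaust all others, so one null set serves every
  \<open>x\<close>.\<close>

lemma AE_finite_points:
  "AE \<omega> in M. \<forall>x. finite {j. 1 \<le> j \<and> T j \<omega> \<in> {0<..x}}"
proof -
  have "AE \<omega> in M. \<forall>n::nat. finite {j. 1 \<le> j \<and> T j \<omega> \<in> {0<..real n}}"
    using locally_finite[OF interval_bounded_borel_pos[of 0]] by (simp add: AE_all_countable)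
  then show ?thesis
  proof (rule AE_mp, intro AE_I2 impI allI)
    fix \<omega> x assume a: "\<forall>n::nat. finite {j. 1 \<le> j \<and> T j \<omega> \<in> {0<..real n}}"
    have "{j. 1 \<le> j \<and> T j \<omega> \<in> {0<..x}} \<subseteq> {j. 1 \<le> j \<and> T j \<omega> \<in> {0<..real (nat \<lceil>x\<rceil>)}}"
      by auto linarith
    then show "finite {j. 1 \<le> j \<and> T j \<omega> \<in> {0<..x}}"
      using a finite_subset by blast
  qed
qed

lemma measurable_points_Suc [measurable]: "T (Suc j) \<in> borel_measurable M"
  by (rule measurable_points) simp

lemma first_point_tail:
  assumes "a \<ge> 0"
  shows "prob {\<omega> \<in> space M. a < T 1 \<omega>} = exp (- r * a)"
proof -
  have [measurable]: "T 1 \<in> borel_measurable M" by (rule measurable_points) simp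
  have Z: "AE \<omega> in M. (a < T 1 \<omega>) = (N {0<..a} \<omega> = 0)"
    using AE_finite_points
  proof (rule AE_mp, intro AE_I2 impI)
    fix \<omega> assume w: "\<omega> \<in> space M" "\<forall>x. finite {j. 1 \<le> j \<and> T j \<omega> \<in> {0<..x}}"
    show "(a < T 1 \<omega>) = (N {0<..a} \<omega> = 0)"
      using count_le_imp[OF w(1), of 1 a] count_ge_if[OF w(1), of 1 a] w(2) by force
  qed
  note [measurable] = measurable_count[OF interval_bounded_borel_pos[OF order_refl, of a]]
  have "prob {\<omega> \<in> space M. a < T 1 \<omega>} = prob {\<omega> \<in> space M. N {0<..a} \<omega> = 0}"
    using Z by (intro finite_measure_eq_AE) auto
  also have "\<dots> = exp (- r * a)"
    using poisson_counts[OF interval_bounded_borel_pos[OF order_refl, of a], of 0] assms by simp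
  finally show ?thesis .
qed

lemma first_point_distributed: "distributed M lborel (T 1) (exponential_density r)"
proof -
  have [measurable]: "T 1 \<in> borel_measurable M" by (rule measurable_points) simp
  have "prob {\<omega> \<in> space M. T 1 \<omega> \<le> a} = 1 - exp (- a * r)" if "a \<ge> 0" for a
  proof -
    have "prob {\<omega> \<in> space M. T 1 \<omega> \<le> a} = 1 - prob {\<omega> \<in> space M. a < T 1 \<omega>}"
      by (subst prob_compl[symmetric]) (auto intro!: arg_cong[where f=prob])
    then show ?thesis using first_point_tail[OF that] by (simp add: mult.commute)
  qed
  then show ?thesis
    using intensity_pos by (simp add: exponential_distributed_iff)
qed

text \<open>Chernoff bounds for the counts of \<open>(0, L n]\<close> and \<open>(0, n / L]\<close> at level \<open>n\<close>, with the
  generating function evaluated at \<open>1/2\<close> and at \<open>4\<close>.\<close>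

lemma AE_linear_growth:
  "\<exists>L>0. AE \<omega> in M. eventually (\<lambda>n. real n / L \<le> T n \<omega> \<and> T n \<omega> \<le> L * real n) sequentially"
proof -
  \<comment> \<open>The first entry gives \<open>r * L / 2 >= 2 * ln 2\<close>, which brings
    \<open>2 ^ n * exp (- r * L * n / 2)\<close> below \<open>(1/2) ^ n\<close>. The second gives
    \<open>3 * r / L <= ln 2\<close>, which does the same for
    \<open>(1/4) ^ n * exp (3 * r * n / L)\<close>.\<close>
  define L where "L = max (4 * ln 2 / r + 4) (3 * r / ln 2)"
  have L: "L > 0" "r * L / 2 \<ge> 2 * ln 2" "3 * r / L \<le> ln 2"
  proof -
    have "L \<ge> 4 * ln 2 / r + 4" by (simp add: L_def)
    moreover have "4 * ln 2 / r > 0" using intensity_pos by simp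
    ultimately show "L > 0" by linarith
    have "L \<ge> 4 * ln 2 / r" using \<open>L \<ge> 4 * ln 2 / r + 4\<close> by linarith
    then show "r * L / 2 \<ge> 2 * ln 2" using intensity_pos by (simp add: field_simps)
    have "L \<ge> 3 * r / ln 2" by (simp add: L_def)
    then show "3 * r / L \<le> ln 2" using \<open>L > 0\<close> by (simp add: field_simps)
  qed
  define A where "A n = {\<omega> \<in> space M. N {0<..L * real n} \<omega> < n}" for n
  define C where "C n = {\<omega> \<in> space M. N {0<..real n / L} \<omega> \<ge> n}" for n
  have mL[measurable]: "N {0<..L * real n} \<in> measurable M (count_space UNIV)"
      "N {0<..real n / L} \<in> measurable M (count_space UNIV)" for n
    by (auto intro!: measurable_count interval_bounded_borel_pos)
  have [measurable]: "A n \<in> sets M" "C n \<in> sets M" for n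
    by (auto simp: A_def C_def)
  have A: "measure M (A n) \<le> (1/2) ^ n" for n
  proof -
    have B: "{0<..L * real n} \<in> bounded_borel_pos" by (rule interval_bounded_borel_pos) simp
    have "measure M (A n) = expectation (indicator (A n))" by simp
    also have "\<dots> \<le> expectation (\<lambda>\<omega>. 2 ^ n * (1/2) ^ N {0<..L * real n} \<omega>)"
    proof (rule integral_mono)
      show "integrable M (\<lambda>\<omega>. 2 ^ n * (1/2::real) ^ N {0<..L * real n} \<omega>)"
        by (intro integrable_mult_right count_generating_function B)
      fix \<omega> 
      have "(1/2::real) ^ n \<le> (1/2) ^ N {0<..L * real n} \<omega>" if "\<omega> \<in> A n"
        using that by (intro power_decreasing) (auto simp: A_def)
      then have "1 \<le> 2 ^ n * (1/2::real) ^ N {0<..L * real n} \<omega>" if "\<omega> \<in> A n"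
        using that by (simp add: field_simps power_divide)
      then show "indicator (A n) \<omega> \<le> 2 ^ n * (1/2::real) ^ N {0<..L * real n} \<omega>"
        by (simp add: indicator_def)
    qed (auto simp: integrable_indicator_iff emeasure_eq_measure)
    also have "\<dots> = 2 ^ n * exp (r * (L * real n) * (1/2 - 1))"
      using count_generating_function(2)[OF B, of "1/2::real"] L(1) by simp
    also have "\<dots> = 2 ^ n * exp (- (r * L / 2)) ^ n"
      by (simp add: exp_of_nat_mult[symmetric])
    also have "\<dots> \<le> 2 ^ n * exp (- (2 * ln 2)) ^ n"
      using L by (intro mult_left_mono power_mono) auto
    also have "exp (- (2 * ln 2)) = (1/4::real)"
      using exp_of_nat_mult[of 2 "- ln (2::real)"] by (simp add: exp_minus power2_eq_square field_simps)
    also have "2 ^ n * (1/4::real) ^ n = (1/2) ^ n" by (simp add: power_mult_distrib[symmetric])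
    finally show ?thesis .
  qed
  have C: "measure M (C n) \<le> (1/2) ^ n" for n
  proof -
    have B: "{0<..real n / L} \<in> bounded_borel_pos" by (rule interval_bounded_borel_pos) simp
    have "measure M (C n) = expectation (indicator (C n))" by simp
    also have "\<dots> \<le> expectation (\<lambda>\<omega>. (1/4) ^ n * 4 ^ N {0<..real n / L} \<omega>)"
    proof (rule integral_mono)
      show "integrable M (\<lambda>\<omega>. (1/4) ^ n * (4::real) ^ N {0<..real n / L} \<omega>)"
        by (intro integrable_mult_right count_generating_function B)
      fix \<omega> 
      have "(4::real) ^ n \<le> 4 ^ N {0<..real n / L} \<omega>" if "\<omega> \<in> C n"
        using that by (intro power_increasing) (auto simp: C_def)
      then have "1 \<le> (1/4) ^ n * (4::real) ^ N {0<..real n / L} \<omega>" if "\<omega> \<in> C n"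
        using that by (simp add: field_simps power_divide)
      then show "indicator (C n) \<omega> \<le> (1/4) ^ n * (4::real) ^ N {0<..real n / L} \<omega>"
        by (simp add: indicator_def)
    qed (auto simp: integrable_indicator_iff emeasure_eq_measure)
    also have "\<dots> = (1/4) ^ n * exp (r * (real n / L) * (4 - 1))"
      using count_generating_function(2)[OF B, of "4::real"] L(1) by simp
    also have "\<dots> = (1/4) ^ n * exp (3 * r / L) ^ n"
      by (simp add: exp_of_nat_mult[symmetric] mult_ac)
    also have "\<dots> \<le> (1/4) ^ n * exp (ln 2) ^ n"
      using L by (intro mult_left_mono power_mono iffD2[OF exp_le_cancel_iff]) auto
    also have "\<dots> = (1/2) ^ n" by (simp add: power_mult_distrib[symmetric])
    finally show ?thesis .
  qed
  have s: "summable (\<lambda>n. (1/2::real) ^ n)" by (rule summable_geometric) simp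
  have "AE \<omega> in M. eventually (\<lambda>n. \<omega> \<in> space M - A n) sequentially"
    by (rule borel_cantelli_AE1) (auto simp: emeasure_eq_measure intro!: summable_comparison_test[OF _ s] A)
  moreover have "AE \<omega> in M. eventually (\<lambda>n. \<omega> \<in> space M - C n) sequentially"
    by (rule borel_cantelli_AE1) (auto simp: emeasure_eq_measure intro!: summable_comparison_test[OF _ s] C)
  ultimately have "AE \<omega> in M. eventually (\<lambda>n. real n / L \<le> T n \<omega> \<and> T n \<omega> \<le> L * real n) sequentially"
    using AE_finite_points AE_space
  proof eventually_elim
    case (elim \<omega>)
    from elim(1,2) eventually_ge_at_top[of 1] show ?case
    proof eventually_elim
      case (elim n)
      then show ?case
        using count_le_imp[of \<omega> n "L * real n"] count_ge_if[of \<omega> n "real n / L"]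
           \<open>\<forall>x. finite _\<close> by (auto simp: A_def C_def not_less not_le) force
    qed
  qed
  then show ?thesis using L(1) by blast
qed

end

lemma norm_cis_minus_one_le: "norm (cis x - 1) \<le> \<bar>x\<bar>"
  using iexp_approx1[of x 0] by (simp add: cis_conv_exp)

lemma point_count_eq_card_Suc: "point_count t B = card {j. t (Suc j) \<in> B}"
proof -
  have "{j. 1 \<le> j \<and> t j \<in> B} = Suc ` {j. t (Suc j) \<in> B}"
    by (auto simp: image_iff) (metis Suc_pred Suc_le_eq)
  then show ?thesis by (simp add: point_count_def card_image)
qed

section \<open>Power sums over the points, and the characteristic functional\<close>

context poisson_process
begin

lemma AE_summable_powr:
  assumes "b > 1"
  shows "AE \<omega> in M. summable (\<lambda>j. T (Suc j) \<omega> powr - b)"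
proof -
  obtain L where L: "L > 0"
      "AE \<omega> in M. eventually (\<lambda>n. real n / L \<le> T n \<omega> \<and> T n \<omega> \<le> L * real n) sequentially"
    using AE_linear_growth by blast
  show ?thesis
    using L(2)
  proof (rule AE_mp, intro AE_I2 impI)
    fix \<omega> assume "eventually (\<lambda>n. real n / L \<le> T n \<omega> \<and> T n \<omega> \<le> L * real n) sequentially"
    then have "eventually (\<lambda>n. norm (T n \<omega> powr - b) \<le> L powr b * real n powr - b) sequentially"
      using eventually_gt_at_top[of 0]
    proof eventually_elim
      case (elim n)
      have "T n \<omega> powr - b \<le> (real n / L) powr - b"
        using elim L(1) assms by (intro powr_mono2') auto
      also have "\<dots> = L powr b * real n powr - b"
        using L(1) by (simp add: powr_divide powr_minus divide_simps)
      finally show ?case by simp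
    qed
    moreover have "summable (\<lambda>n. L powr b * real n powr - b)"
      using assms by (intro summable_mult) (simp add: summable_real_powr_iff)
    ultimately have "summable (\<lambda>n. T n \<omega> powr - b)"
      by (rule summable_comparison_test_ev)
    then show "summable (\<lambda>j. T (Suc j) \<omega> powr - b)"
      by (subst summable_Suc_iff)
  qed
qed

text \<open>By linear growth the terms dominate a multiple of the harmonic series. With
  \<open>AE_summable_powr\<close> the critical exponent is therefore exactly \<open>1\<close>, and
  divergence there is what forces the normalised sum above \<open>1\<close> for exponents close to
  it.\<close>

lemma AE_not_summable_inverse: "AE \<omega> in M. \<not> summable (\<lambda>j. T (Suc j) \<omega> powr - 1)"
proof -
  obtain L where L: "L > 0"
      "AE \<omega> in M. eventually (\<lambda>n. real n / L \<le> T n \<omega> \<and> T n \<omega> \<le> L * real n) sequentially"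
    using AE_linear_growth by blast
  show ?thesis
    using L(2) AE_space
  proof eventually_elim
    fix \<omega> assume w: "\<omega> \<in> space M" and "eventually (\<lambda>n. real n / L \<le> T n \<omega> \<and> T n \<omega> \<le> L * real n) sequentially"
    from this(2) have ev: "eventually (\<lambda>n. norm (1 / L * real n powr - 1) \<le> T n \<omega> powr - 1) sequentially"
      using eventually_gt_at_top[of 0]
    proof eventually_elim
      case (elim n)
      have "1 / L * real n powr - 1 = (L * real n) powr - 1"
        using L(1) elim by (simp add: powr_minus_divide)
      also have "\<dots> \<le> T n \<omega> powr - 1"
        using elim point_pos[OF w, of n] by (intro powr_mono2') auto
      finally show ?case using L(1) by simp
    qed
    show "\<not> summable (\<lambda>j. T (Suc j) \<omega> powr - 1)"
    proof
      assume "summable (\<lambda>j. T (Suc j) \<omega> powr - 1)"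
      then have "summable (\<lambda>n. T n \<omega> powr - 1)" by (subst (asm) summable_Suc_iff)
      from summable_comparison_test_ev[OF ev this]
      have "summable (\<lambda>n. 1 / L * real n powr - 1)" .
      from summable_mult[OF this, of L] have "summable (\<lambda>n. real n powr - 1)"
        using L(1) by simp
      then show False using summable_real_powr_iff[of "- 1"] by simp
    qed
  qed
qed

text \<open>Dyadic simple functions below \<open>k\<close> reduce the sum over the points to counts
  of finitely many disjoint sets, whose joint generating function is known; dominated convergence
  then passes to \<open>k\<close>. The void event \<open>a < T 1\<close> is carried along as one
  more count, which stays disjoint from the others because \<open>k\<close> vanishes up to
  \<open>a\<close>.\<close>

lemma characteristic_functional:
  fixes k :: "real \<Rightarrow> real"
  assumes k_int: "integrable lborel k" and k0: "\<And>u. k u \<ge> 0"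
    and a: "a \<ge> 0" and ka: "\<And>u. u \<le> a \<Longrightarrow> k u = 0"
    and summ: "AE \<omega> in M. summable (\<lambda>j. k (T (Suc j) \<omega>))"
  shows "expectation (\<lambda>\<omega>. of_bool (a < T 1 \<omega>) * cis (\<Sum>j. k (T (Suc j) \<omega>)))
     = exp (of_real (- r * a)) * exp (of_real r * (LINT u|lborel. cis (k u) - 1))"
proof -
  have k_meas[measurable]: "k \<in> borel_measurable borel" 
    using borel_measurable_integrable[OF k_int] by simp
  \<comment> \<open>Cutting off both height and position at \<open>i\<close> leaves finitely many
    levels with bounded level sets, as the counting axioms demand.\<close>
  define m where "m i u = (if 0 < u \<and> u \<le> real i then nat \<lfloor>min (real i) (k u) * 2 ^ i\<rfloor> else 0)" for i :: nat and u
  define \<kappa> where "\<kappa> i u = real (m i u) / 2 ^ i" for i u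
  define B where "B i l = (if l = 0 then {0<..a} else {u. 0 < u \<and> u \<le> real i \<and> m i u = l})" for i l
  define K where "K i = i * 2 ^ i" for i :: nat
  \<comment> \<open>Weight \<open>0\<close> on \<open>{0<..a}\<close> encodes the void event, as
    \<open>0 ^ n\<close> is \<open>1\<close> for \<open>n = 0\<close> and \<open>0\<close>
    otherwise.\<close>
  define z where "z i l = (if l = 0 then 0 else cis (real l / 2 ^ i))" for i l :: nat
  have m_meas[measurable]: "m i \<in> measurable borel (count_space UNIV)" for i
    unfolding m_def by measurable
  have mK: "m i u \<le> K i" for i u
  proof -
    have "\<lfloor>min (real i) (k u) * 2 ^ i\<rfloor> \<le> int (i * 2 ^ i)"
      by (simp add: floor_le_iff) (smt (verit) mult_right_mono zero_le_power)
    then show ?thesis by (auto simp: m_def K_def nat_le_iff)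
  qed
  have \<kappa>0: "\<kappa> i u \<ge> 0" for i u by (simp add: \<kappa>_def)
  have \<kappa>k: "\<kappa> i u \<le> k u" for i u
  proof -
    have "real (m i u) \<le> min (real i) (k u) * 2 ^ i"
      using k0[of u] by (auto simp: m_def)
    also have "\<dots> \<le> k u * 2 ^ i" by (intro mult_right_mono) auto
    finally show ?thesis by (simp add: \<kappa>_def field_simps)
  qed
  have \<kappa>lim: "(\<lambda>i. \<kappa> i u) \<longlonglongrightarrow> k u" for u
  proof (cases "u \<le> 0")
    case True
    then have "k u = 0" using ka[of u] a by auto
    with True show ?thesis by (simp add: \<kappa>_def m_def)
  next
    case False
    have ev: "eventually (\<lambda>i. k u - (1/2) ^ i \<le> \<kappa> i u) sequentially"
      using eventually_ge_at_top[of "nat \<lceil>max u (k u)\<rceil>"]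
    proof eventually_elim
      case (elim i)
      then have *: "u \<le> real i" "k u \<le> real i" by linarith+
      then have "real (m i u) = of_int \<lfloor>k u * 2 ^ i\<rfloor>" using False k0[of u]
        by (simp add: m_def min_def)
      then have "k u * 2 ^ i - 1 \<le> real (m i u)" by linarith
      then have "(k u * 2 ^ i - 1) / 2 ^ i \<le> \<kappa> i u"
        unfolding \<kappa>_def by (intro divide_right_mono) auto
      also have "(k u * 2 ^ i - 1) / 2 ^ i = k u - (1/2) ^ i"
        by (simp add: field_simps power_divide)
      finally show ?case .
    qed
    have "(\<lambda>i. k u - (1/2) ^ i) \<longlonglongrightarrow> k u - 0"
      by (intro tendsto_intros LIMSEQ_power_zero) auto
    then have "(\<lambda>i. k u - (1/2) ^ i) \<longlonglongrightarrow> k u" by simp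
    from tendsto_sandwich[OF ev always_eventually[OF allI[OF \<kappa>k]] this tendsto_const]
    show ?thesis .
  qed
  have Bb: "B i l \<in> bounded_borel_pos" for i l
  proof (cases "l = 0")
    case True then show ?thesis by (simp add: B_def interval_bounded_borel_pos)
  next
    case False
    have "{u \<in> space borel. 0 < u \<and> u \<le> real i \<and> m i u = l} \<in> sets borel" by measurable
    then have "{u. 0 < u \<and> u \<le> real i \<and> m i u = l} \<in> sets borel" by simp
    moreover have "bounded {u. 0 < u \<and> u \<le> real i \<and> m i u = l}"
      by (rule bounded_subset[OF bounded_closed_interval[of 0 "real i"]]) auto
    ultimately have "{u. 0 < u \<and> u \<le> real i \<and> m i u = l} \<in> bounded_borel_pos"
      unfolding bounded_borel_pos_def by blast
    then show ?thesis using False by (simp add: B_def)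
  qed
  have disj: "disjoint_family_on (B i) {0..K i}" for i
  proof -
    have "m i u = 0" if "u \<le> a" for u using ka[OF that] by (simp add: m_def)
    then show ?thesis by (auto simp: disjoint_family_on_def B_def)
  qed
  have E: "expectation (\<lambda>\<omega>. \<Prod>l\<in>{0..K i}. z i l ^ N (B i l) \<omega>)
      = exp (of_real r * (\<Sum>l\<in>{0..K i}. of_real (measure lborel (B i l)) * (z i l - 1)))" for i
    by (rule joint_generating_function) (use Bb disj in auto)
  \<comment> \<open>The set with index \<open>0\<close> contributes \<open>a * (0 - 1)\<close>, the
    exponent of the void probability; the other levels add up to the integral of the simple
    function.\<close>
  have R: "(\<Sum>l\<in>{0..K i}. of_real (measure lborel (B i l)) * (z i l - 1))
      = - of_real a + (LINT u|lborel. cis (\<kappa> i u) - 1)" for i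
  proof -
    have fin: "emeasure lborel (B i l) < \<infinity>" and [measurable]: "B i l \<in> sets borel" for l
      using Bb[of i l] emeasure_bounded_finite[of "B i l"] by (simp_all add: bounded_borel_pos_def)
    have "cis (\<kappa> i u) - 1 = (\<Sum>l\<in>{1..K i}. indicator (B i l) u *\<^sub>R (cis (real l / 2 ^ i) - 1))" for u
    proof (cases "m i u = 0")
      case True
      then have "(\<Sum>l\<in>{1..K i}. indicator (B i l) u *\<^sub>R (cis (real l / 2 ^ i) - 1)) = 0"
        by (intro sum.neutral) (auto simp: B_def indicator_def)
      with True show ?thesis by (simp add: \<kappa>_def)
    next
      case False
      then have u: "0 < u" "u \<le> real i" by (auto simp: m_def split: if_splits)
      have "(\<Sum>l\<in>{1..K i}. indicator (B i l) u *\<^sub>R (cis (real l / 2 ^ i) - 1))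
         = (\<Sum>l\<in>{1..K i}. if m i u = l then cis (real l / 2 ^ i) - 1 else 0)"
        using u by (intro sum.cong) (auto simp: B_def indicator_def)
      also have "\<dots> = cis (\<kappa> i u) - 1"
        using False mK[of i u] by (simp add: \<kappa>_def)
      finally show ?thesis by simp
    qed
    then have "(LINT u|lborel. cis (\<kappa> i u) - 1)
       = (LINT u|lborel. (\<Sum>l\<in>{1..K i}. indicator (B i l) u *\<^sub>R (cis (real l / 2 ^ i) - 1)))"
      by (intro Bochner_Integration.integral_cong) auto
    also have "\<dots> = (\<Sum>l\<in>{1..K i}. LINT u|lborel. indicator (B i l) u *\<^sub>R (cis (real l / 2 ^ i) - 1))"
      using fin by (intro Bochner_Integration.integral_sum) auto
    also have "\<dots> = (\<Sum>l\<in>{1..K i}. of_real (measure lborel (B i l)) * (z i l - 1))"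
      using fin by (intro sum.cong) (auto simp: z_def scaleR_conv_of_real)
    finally have 1: "(LINT u|lborel. cis (\<kappa> i u) - 1) = \<dots>" .
    have "{0..K i} = insert 0 {1..K i}" by auto
    then show ?thesis
      using a by (simp add: 1 z_def B_def)
  qed
  have P: "AE \<omega> in M. (\<Prod>l\<in>{0..K i}. z i l ^ N (B i l) \<omega>)
      = of_bool (a < T 1 \<omega>) * cis (\<Sum>j. \<kappa> i (T (Suc j) \<omega>))" for i
    using AE_finite_points AE_space
  proof eventually_elim
    fix \<omega> assume fin: "\<forall>x. finite {j. 1 \<le> j \<and> T j \<omega> \<in> {0<..x}}" and w: "\<omega> \<in> space M"
    have 0: "(N {0<..a} \<omega> = 0) = (a < T 1 \<omega>)"
      using count_le_imp[OF w, of 1 a] count_ge_if[OF w, of 1 a] fin by force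
    define J where "J = {j. T (Suc j) \<omega> \<in> {0<..real i}}"
    have "Suc ` J \<subseteq> {j. 1 \<le> j \<and> T j \<omega> \<in> {0<..real i}}" by (auto simp: J_def)
    from finite_subset[OF this] have "finite (Suc ` J)" using fin by simp
    then have J: "finite J" by (rule finite_imageD) simp
    have "N (B i l) \<omega> = (\<Sum>j\<in>J. of_bool (m i (T (Suc j) \<omega>) = l))" if "l \<ge> 1" for l
    proof -
      have "{j. T (Suc j) \<omega> \<in> B i l} = {j \<in> J. m i (T (Suc j) \<omega>) = l}"
        using that by (auto simp: B_def J_def)
      then show ?thesis using J by (simp add: point_count_eq_card_Suc sum_of_bool_eq Int_def)
    qed
    then have "(\<Sum>l\<in>{1..K i}. real (N (B i l) \<omega>) * (real l / 2 ^ i))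
       = (\<Sum>l\<in>{1..K i}. \<Sum>j\<in>J. of_bool (m i (T (Suc j) \<omega>) = l) * (real l / 2 ^ i))"
      by (intro sum.cong refl) (simp add: sum_distrib_right sum_divide_distrib
        del: sum_of_bool_eq sum_mult_of_bool_eq sum_of_bool_mult_eq)
    also have "\<dots> = (\<Sum>j\<in>J. \<Sum>l\<in>{1..K i}. of_bool (m i (T (Suc j) \<omega>) = l) * (real l / 2 ^ i))"
      by (rule sum.swap)
    also have "\<dots> = (\<Sum>j\<in>J. \<kappa> i (T (Suc j) \<omega>))"
    proof (intro sum.cong refl)
      fix j
      have "(\<Sum>l\<in>{1..K i}. of_bool (m i (T (Suc j) \<omega>) = l) * (real l / 2 ^ i))
         = (\<Sum>l\<in>{1..K i}. if m i (T (Suc j) \<omega>) = l then real l / 2 ^ i else 0)"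
        by (intro sum.cong) auto
      also have "\<dots> = \<kappa> i (T (Suc j) \<omega>)"
        using mK[of i "T (Suc j) \<omega>"] by (cases "m i (T (Suc j) \<omega>)") (auto simp: \<kappa>_def)
      finally show "(\<Sum>l\<in>{1..K i}. of_bool (m i (T (Suc j) \<omega>) = l) * (real l / 2 ^ i))
         = \<kappa> i (T (Suc j) \<omega>)" .
    qed
    also have "\<dots> = (\<Sum>j. \<kappa> i (T (Suc j) \<omega>))"
      by (rule suminf_finite[symmetric]) (use J in \<open>auto simp: J_def \<kappa>_def m_def\<close>)
    finally have S: "(\<Sum>l\<in>{1..K i}. real (N (B i l) \<omega>) * (real l / 2 ^ i)) = \<dots>" .
    have "(\<Prod>l\<in>{1..K i}. z i l ^ N (B i l) \<omega>)
       = (\<Prod>l\<in>{1..K i}. cis (real (N (B i l) \<omega>) * (real l / 2 ^ i)))"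
      by (intro prod.cong) (auto simp: z_def Complex.DeMoivre)
    also have "\<dots> = cis (\<Sum>l\<in>{1..K i}. real (N (B i l) \<omega>) * (real l / 2 ^ i))"
      unfolding cis_conv_exp by (simp add: exp_sum[symmetric] sum_distrib_left)
    finally have 1: "(\<Prod>l\<in>{1..K i}. z i l ^ N (B i l) \<omega>) = cis (\<Sum>j. \<kappa> i (T (Suc j) \<omega>))"
      by (simp only: S)
    have "(\<Prod>l\<in>{0..K i}. z i l ^ N (B i l) \<omega>)
        = z i 0 ^ N (B i 0) \<omega> * (\<Prod>l\<in>{1..K i}. z i l ^ N (B i l) \<omega>)"
      by (simp add: prod.atLeast_Suc_atMost)
    moreover have "z i 0 ^ N (B i 0) \<omega> = of_bool (a < T 1 \<omega>)"
      using 0 by (simp add: z_def B_def power_0_left)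
    ultimately show "(\<Prod>l\<in>{0..K i}. z i l ^ N (B i l) \<omega>)
      = of_bool (a < T 1 \<omega>) * cis (\<Sum>j. \<kappa> i (T (Suc j) \<omega>))"
      by (simp only: 1)
  qed
  have [measurable]: "T 1 \<in> borel_measurable M" by (rule measurable_points) simp
  have \<kappa>_meas[measurable]: "\<kappa> i \<in> borel_measurable borel" for i
    unfolding \<kappa>_def by measurable
  have cis_meas: "cis \<in> borel_measurable borel"
    by (intro borel_measurable_continuous_onI continuous_intros)
  note [measurable] = measurable_compose[OF _ cis_meas]
  have 1: "(\<lambda>i. expectation (\<lambda>\<omega>. of_bool (a < T 1 \<omega>) * cis (\<Sum>j. \<kappa> i (T (Suc j) \<omega>))))
     \<longlonglongrightarrow> expectation (\<lambda>\<omega>. of_bool (a < T 1 \<omega>) * cis (\<Sum>j. k (T (Suc j) \<omega>)))"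
  proof (rule integral_dominated_convergence[where w="\<lambda>_. 1"])
    show "AE \<omega> in M. (\<lambda>i. of_bool (a < T 1 \<omega>) * cis (\<Sum>j. \<kappa> i (T (Suc j) \<omega>)))
       \<longlonglongrightarrow> of_bool (a < T 1 \<omega>) * cis (\<Sum>j. k (T (Suc j) \<omega>))"
      using summ
    proof eventually_elim
      case (elim \<omega>)
      \<comment> \<open>Limit and series are exchanged by Tannery's theorem: along the points
        \<open>k\<close> dominates all approximations, and it is summable there.\<close>
      have "(\<lambda>i. (\<Sum>j. \<kappa> i (T (Suc j) \<omega>))) \<longlonglongrightarrow> (\<Sum>j. k (T (Suc j) \<omega>))"
        using tannerys_theorem[of "\<lambda>j i. \<kappa> i (T (Suc j) \<omega>)" "\<lambda>j. k (T (Suc j) \<omega>)" sequentially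
            "\<lambda>j. k (T (Suc j) \<omega>)"] \<kappa>lim elim \<kappa>k \<kappa>0 by (auto simp: case_prod_unfold)
      then show ?case
        by (intro tendsto_intros tendsto_cis)
    qed
    show "AE \<omega> in M. norm (of_bool (a < T 1 \<omega>) * cis (\<Sum>j. \<kappa> i (T (Suc j) \<omega>))) \<le> 1" for i
      by (auto simp: norm_mult)
  qed auto
  have 2: "(\<lambda>i. LINT u|lborel. cis (\<kappa> i u) - 1) \<longlonglongrightarrow> (LINT u|lborel. cis (k u) - 1)"
  proof (rule integral_dominated_convergence[where w=k])
    show "AE u in lborel. (\<lambda>i. cis (\<kappa> i u) - 1) \<longlonglongrightarrow> cis (k u) - 1"
      by (intro AE_I2 tendsto_intros tendsto_cis \<kappa>lim)
    show "AE u in lborel. norm (cis (\<kappa> i u) - 1) \<le> k u" for i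
      by (intro AE_I2 order_trans[OF norm_cis_minus_one_le]) (use \<kappa>0 \<kappa>k in auto)
  qed (use k_int in auto)
  have "expectation (\<lambda>\<omega>. of_bool (a < T 1 \<omega>) * cis (\<Sum>j. \<kappa> i (T (Suc j) \<omega>)))
      = exp (of_real r * (- of_real a + (LINT u|lborel. cis (\<kappa> i u) - 1)))" for i
  proof -
    have mB[measurable]: "N (B i l) \<in> measurable M (count_space UNIV)" for l
      by (rule measurable_count[OF Bb])
    have "expectation (\<lambda>\<omega>. of_bool (a < T 1 \<omega>) * cis (\<Sum>j. \<kappa> i (T (Suc j) \<omega>)))
       = expectation (\<lambda>\<omega>. \<Prod>l\<in>{0..K i}. z i l ^ N (B i l) \<omega>)"
      using P[of i] by (intro integral_cong_AE) auto
    then show ?thesis by (simp only: E R)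
  qed
  then have "(\<lambda>i. expectation (\<lambda>\<omega>. of_bool (a < T 1 \<omega>) * cis (\<Sum>j. \<kappa> i (T (Suc j) \<omega>))))
     \<longlonglongrightarrow> exp (of_real r * (- of_real a + (LINT u|lborel. cis (k u) - 1)))"
    using 2 by (auto intro!: tendsto_intros)
  from LIMSEQ_unique[OF 1 this] show ?thesis
    by (simp add: exp_add[symmetric] algebra_simps)
qed

end

section \<open>The exponent of the characteristic function\<close>

text \<open>By Campbell's formula, at rate \<open>r\<close> and for \<open>v > 0\<close>,
  \<open>exp (r * tail_exponent b v)\<close> is the characteristic function at \<open>1\<close> of
  the sum of \<open>T j powr - b\<close> over the points beyond \<open>v\<close>. The
  \<open>- v\<close> in \<open>full_exponent\<close> accounts for the probability
  \<open>exp (- r * v)\<close> that no point precedes \<open>v\<close>.\<close>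

definition tail_exponent :: "real \<Rightarrow> real \<Rightarrow> complex" where
  "tail_exponent b v = (LINT u|lborel. (if v < u then cis (u powr - b) - 1 else 0))"

definition full_exponent :: "real \<Rightarrow> real \<Rightarrow> complex" where
  "full_exponent b v = tail_exponent b v - of_real v"

lemma borel_measurable_cis [measurable (raw)]:
  "f \<in> borel_measurable M \<Longrightarrow> (\<lambda>x. cis (f x)) \<in> borel_measurable M"
  by (rule measurable_compose[of f M borel cis])
     (auto intro!: borel_measurable_continuous_onI continuous_intros)

lemma tail_exponent_measurable [measurable]: "tail_exponent b \<in> borel_measurable borel"
  unfolding tail_exponent_def by measurable

lemma full_exponent_measurable [measurable]: "full_exponent b \<in> borel_measurable borel"
  unfolding full_exponent_def by measurable

context
  fixes b :: real
  assumes b: "b > 1"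
begin

lemma tail_powr:
  assumes "v > 0"
  shows "has_bochner_integral lborel (\<lambda>u. if v < u then u powr - b else 0) (v powr (1 - b) / (b - 1))"
proof -
  have "((\<lambda>u. u powr - b) has_integral - (v powr (- b + 1)) / (- b + 1)) {v..}"
    using assms b by (intro has_integral_powr_to_inf) auto
  also have "- (v powr (- b + 1)) / (- b + 1) = v powr (1 - b) / (b - 1)"
    using b by (simp add: field_simps)
  finally have "((\<lambda>u. u powr - b) has_integral v powr (1 - b) / (b - 1)) {v..}" .
  then have "((\<lambda>u. if u \<in> {v..} then u powr - b else 0) has_integral v powr (1 - b) / (b - 1)) UNIV"
    by (subst has_integral_restrict_UNIV)
  then have "has_bochner_integral lborel (\<lambda>u. if u \<in> {v..} then u powr - b else 0) (v powr (1 - b) / (b - 1))"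
    using b by (intro has_bochner_integral_nn_integral nn_integral_has_integral_lborel) auto
  moreover have ae: "AE u in lborel. (if u \<in> {v..} then u powr - b else 0) = (if v < u then u powr - b else 0)"
    using AE_lborel_singleton[of v] by eventually_elim auto
  ultimately show ?thesis
    using has_bochner_integral_cong_AE[OF _ _ ae, of "v powr (1 - b) / (b - 1)"] by simp
qed

lemma tail_exponent_integrable:
  assumes "v > 0"
  shows "integrable lborel (\<lambda>u. if v < u then cis (u powr - b) - 1 else 0)"
proof (rule Bochner_Integration.integrable_bound)
  show "integrable lborel (\<lambda>u. if v < u then u powr - b else 0)"
    using tail_powr[OF assms] by (rule has_bochner_integral_iff[THEN iffD1, THEN conjunct1])
  show "AE u in lborel. norm (if v < u then cis (u powr - b) - 1 else 0)
      \<le> norm (if v < u then u powr - b else 0)"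
    using norm_cis_minus_one_le[of "_ powr - b"] by (auto intro!: AE_I2)
qed measurable

lemma norm_tail_exponent_le:
  assumes "v > 0"
  shows "norm (tail_exponent b v) \<le> v powr (1 - b) / (b - 1)"
proof -
  have "norm (tail_exponent b v) \<le> (LINT u|lborel. norm (if v < u then cis (u powr - b) - 1 else 0))"
    unfolding tail_exponent_def by (rule integral_norm_bound)
  also have "\<dots> \<le> (LINT u|lborel. (if v < u then u powr - b else 0))"
    using tail_powr[OF assms] tail_exponent_integrable[OF assms] norm_cis_minus_one_le[of "_ powr - b"]
    by (intro Bochner_Integration.integral_mono integrable_norm) (auto simp: has_bochner_integral_iff)
  also have "\<dots> = v powr (1 - b) / (b - 1)"
    using tail_powr[OF assms] by (simp add: has_bochner_integral_iff)
  finally show ?thesis .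
qed

lemma Re_tail_exponent:
  assumes "v > 0"
  shows "integrable lborel (\<lambda>u. if v < u then cos (u powr - b) - 1 else 0)"
    and "Re (tail_exponent b v) = (LINT u|lborel. (if v < u then cos (u powr - b) - 1 else 0))"
proof -
  have *: "Re (if v < u then cis (u powr - b) - 1 else 0) = (if v < u then cos (u powr - b) - 1 else 0)" for u
    by simp
  show "integrable lborel (\<lambda>u. if v < u then cos (u powr - b) - 1 else 0)"
    using integrable_Re[OF tail_exponent_integrable[OF assms]] by (simp only: *)
  show "Re (tail_exponent b v) = (LINT u|lborel. (if v < u then cos (u powr - b) - 1 else 0))"
    unfolding tail_exponent_def using integral_Re[OF tail_exponent_integrable[OF assms]] by (simp only: *)
qed

lemma Re_tail_exponent_nonpos:
  assumes "v > 0"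
  shows "Re (tail_exponent b v) \<le> 0"
proof -
  have "0 \<le> (LINT u|lborel. - (if v < u then cos (u powr - b) - 1 else 0))"
    by (rule Bochner_Integration.integral_nonneg) auto
  then show ?thesis by (simp add: Re_tail_exponent(2)[OF assms])
qed

lemma Re_tail_exponent_mono:
  assumes "0 < v" "v \<le> w"
  shows "Re (tail_exponent b v) \<le> Re (tail_exponent b w)"
  unfolding Re_tail_exponent(2)[OF assms(1)] Re_tail_exponent(2)[OF less_le_trans[OF assms]]
  using assms by (intro Bochner_Integration.integral_mono Re_tail_exponent) auto

text \<open>Otherwise the non-negative function \<open>1 - cos (u powr - b)\<close> would vanish for
  almost every \<open>u > 1\<close>; but there the argument of \<open>cos\<close> lies in
  \<open>(0, 1]\<close>, where \<open>cos\<close> stays below \<open>1\<close>.\<close>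

lemma Re_tail_exponent_1_neg: "Re (tail_exponent b 1) < 0"
proof (rule ccontr)
  assume "\<not> Re (tail_exponent b 1) < 0"
  then have "(LINT u|lborel. - (if 1 < u then cos (u powr - b) - 1 else 0)) = 0"
    using Re_tail_exponent_nonpos[of 1] Re_tail_exponent(2)[of 1] by simp
  then have "AE u in lborel. - (if 1 < u then cos (u powr - b) - 1 else 0) = (0::real)"
    using Re_tail_exponent(1)[of 1] by (subst (asm) integral_nonneg_eq_0_iff_AE) auto
  then have "AE u::real in lborel. \<not> (1 < u \<and> u < 2)"
  proof eventually_elim
    case (elim u)
    have "cos (u powr - b) < 1" if "1 < u"
    proof -
      have "u powr - b \<le> 1 powr - b" using that b by (intro powr_mono2') auto
      moreover have "u powr - b > 0" using that by simp
      ultimately show ?thesis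
        using cos_monotone_0_pi[of 0 "u powr - b"] pi_gt3 by simp
    qed
    then show ?case using elim by (auto split: if_splits)
  qed
  then have "emeasure lborel {1<..<2::real} = 0"
    by (subst (asm) AE_iff_measurable[of "{1<..<2}"]) auto
  then show False by simp
qed

text \<open>The decay in \<open>s\<close> has to be uniform in \<open>v\<close>. Near
  \<open>v = 0\<close> the term \<open>- v\<close> gives none and the tail integral supplies it by
  monotonicity; for large \<open>v\<close> the tail integral fades and \<open>- v\<close> takes
  over.\<close>

lemma Re_full_exponent_le: "\<exists>\<delta>>0. \<forall>v>0. Re (full_exponent b v) \<le> - \<delta> * (1 + v)"
proof -
  \<comment> \<open>\<open>d\<close> serves both regimes; it is halved below because
    \<open>1 + v\<close> is at most \<open>2\<close> for \<open>v <= 1\<close> and at most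
    \<open>2 * v\<close> beyond.\<close>
  define d where "d = min 1 (- Re (tail_exponent b 1))"
  have d: "0 < d" "d \<le> 1" "Re (tail_exponent b 1) \<le> - d" using Re_tail_exponent_1_neg by (auto simp: d_def)
  have "Re (full_exponent b v) \<le> - (d / 2) * (1 + v)" if "v > 0" for v
  proof (cases "v \<le> 1")
    case True
    then have "Re (full_exponent b v) \<le> - d" using Re_tail_exponent_mono[of v 1] that d by (simp add: full_exponent_def)
    also have "\<dots> \<le> - (d / 2) * (1 + v)"
    proof -
      have "d * v \<le> d * 1" using True d by (intro mult_left_mono) auto
      then show ?thesis by argo
    qed
    finally show ?thesis .
  next
    case False
    then have "Re (full_exponent b v) \<le> - v" using Re_tail_exponent_nonpos[of v] that by (simp add: full_exponent_def)
    also have "\<dots> \<le> - (d / 2) * (1 + v)"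
    proof -
      have "d * (1 + v) \<le> 1 * (1 + v)" using False d by (intro mult_right_mono) auto
      then show ?thesis using False by argo
    qed
    finally show ?thesis .
  qed
  with d(1) show ?thesis by (intro exI[of _ "d / 2"]) auto
qed

lemma Re_full_exponent_neg: "v > 0 \<Longrightarrow> Re (full_exponent b v) < 0"
  using Re_tail_exponent_nonpos[of v] by (simp add: full_exponent_def)

lemma full_exponent_nonzero: "v > 0 \<Longrightarrow> full_exponent b v \<noteq> 0"
  using Re_full_exponent_neg[of v] by auto

lemma tail_exponent_split:
  assumes "0 < w" "w \<le> v"
  shows "tail_exponent b v = tail_exponent b w - integral {w..v} (\<lambda>u. cis (u powr - b) - 1)"
proof -
  have cont: "continuous_on {w..v} (\<lambda>u. cis (u powr - b) - 1)"
    using assms by (intro continuous_intros) auto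
  have si: "set_integrable lborel {w..v} (\<lambda>u. cis (u powr - b) - 1)"
    by (rule borel_integrable_atLeastAtMost'[OF cont])
  have "tail_exponent b w = (LINT u|lborel. indicator {w..v} u *\<^sub>R (cis (u powr - b) - 1)
      + (if v < u then cis (u powr - b) - 1 else 0))"
    unfolding tail_exponent_def
  proof (rule integral_cong_AE)
    show "AE u in lborel. (if w < u then cis (u powr - b) - 1 else 0) =
       indicator {w..v} u *\<^sub>R (cis (u powr - b) - 1) + (if v < u then cis (u powr - b) - 1 else 0)"
      using AE_lborel_singleton[of w] by eventually_elim (use assms in \<open>auto simp: indicator_def\<close>)
  qed measurable
  also have "\<dots> = (LINT u:{w..v}|lborel. cis (u powr - b) - 1) + tail_exponent b v"
    using si tail_exponent_integrable[of v] assms unfolding tail_exponent_def set_integrable_def set_lebesgue_integral_def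
    by (intro Bochner_Integration.integral_add) auto
  also have "(LINT u:{w..v}|lborel. cis (u powr - b) - 1) = integral {w..v} (\<lambda>u. cis (u powr - b) - 1)"
    by (rule set_borel_integral_eq_integral(2)[OF si])
  finally show ?thesis by simp
qed

lemma tail_exponent_has_vector_derivative:
  assumes "v > 0"
  shows "(tail_exponent b has_vector_derivative - (cis (v powr - b) - 1)) (at v)"
proof -
  \<comment> \<open>The interval has \<open>v\<close> in its interior, which makes the derivative
    two-sided, and it keeps clear of the singularity at \<open>0\<close>.\<close>
  have cont: "continuous_on {v/2..2 * v} (\<lambda>u. cis (u powr - b) - 1)"
    using assms by (intro continuous_intros) auto
  have "((\<lambda>x. integral {v/2..x} (\<lambda>u. cis (u powr - b) - 1)) has_vector_derivative
      cis (v powr - b) - 1) (at v within {v/2..2 * v})"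
    using assms by (intro integral_has_vector_derivative[OF cont]) auto
  then have "((\<lambda>x. integral {v/2..x} (\<lambda>u. cis (u powr - b) - 1)) has_vector_derivative
      cis (v powr - b) - 1) (at v)"
    using assms by (subst (asm) at_within_Icc_at) auto
  then have "((\<lambda>x. tail_exponent b (v/2) - integral {v/2..x} (\<lambda>u. cis (u powr - b) - 1)) has_vector_derivative
      0 - (cis (v powr - b) - 1)) (at v)"
    by (intro has_vector_derivative_diff has_vector_derivative_const)
  then have "((\<lambda>x. tail_exponent b (v/2) - integral {v/2..x} (\<lambda>u. cis (u powr - b) - 1)) has_vector_derivative
      - (cis (v powr - b) - 1)) (at v)"
    by simp
  then show ?thesis
    by (rule has_vector_derivative_transform_within_open[of _ _ _ "{v/2<..}"])
       (use assms in \<open>auto intro!: tail_exponent_split[symmetric]\<close>)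
qed

lemma isCont_tail_exponent: "v > 0 \<Longrightarrow> isCont (tail_exponent b) v"
  using tail_exponent_has_vector_derivative has_vector_derivative_continuous by blast

lemma tail_exponent_scale:
  assumes "s > 0"
  shows "(LINT u|lborel. (if x < u then cis ((u / s) powr - b) - 1 else 0)) = of_real s * tail_exponent b (x / s)"
proof -
  have "(LINT u|lborel. (if x < u then cis ((u / s) powr - b) - 1 else 0))
     = \<bar>s\<bar> *\<^sub>R (LINT u|lborel. (if x < 0 + s * u then cis (((0 + s * u) / s) powr - b) - 1 else 0))"
    using assms by (intro lborel_integral_real_affine) auto
  also have "(\<lambda>u. if x < 0 + s * u then cis (((0 + s * u) / s) powr - b) - 1 else 0)
     = (\<lambda>u. if x / s < u then cis (u powr - b) - 1 else 0)"
    using assms by (auto simp: fun_eq_iff field_simps)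
  finally show ?thesis using assms by (simp add: tail_exponent_def scaleR_conv_of_real)
qed

text \<open>Integration by parts in the integral defining \<open>tail_exponent\<close>, followed by the substitution
  \<open>u = v x powr (- 1 / b)\<close>.\<close>

lemma tail_exponent_by_parts:
  assumes v: "v > 0"
  shows "((\<lambda>x. \<i> * of_real (v powr (1 - b)) * of_real (x powr (- 1 / b)) * cis (v powr - b * x)) has_integral
     tail_exponent b v + of_real v * (cis (v powr - b) - 1)) {0..1}"
proof -
  \<comment> \<open>The second summand is the boundary term of the integration by parts: its
    derivative cancels the \<open>cis - 1\<close> coming from \<open>tail_exponent\<close> and
    leaves a pure multiple of \<open>w powr - b * cis (w powr - b)\<close>.\<close>
  define S where "S w = tail_exponent b w + of_real w * (cis (w powr - b) - 1)" for w
  \<comment> \<open>The point \<open>x = 0\<close> corresponds to \<open>w\<close> at infinity,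
    whereas \<open>0 powr (- 1 / b)\<close> is \<open>0\<close>; so the limit of \<open>S\<close>,
    which is \<open>0\<close>, is put in by hand.\<close>
  define R where "R x = (if x = 0 then 0 else S (v * x powr (- 1 / b)))" for x :: real
  have S_lim: "(S \<longlongrightarrow> 0) at_top"
  proof (rule Lim_null_comparison)
    show "eventually (\<lambda>w. norm (S w) \<le> w powr (1 - b) / (b - 1) + w powr (1 - b)) at_top"
      using eventually_gt_at_top[of 0]
    proof eventually_elim
      case (elim w)
      have "norm (S w) \<le> norm (tail_exponent b w) + w * norm (cis (w powr - b) - 1)"
        unfolding S_def using elim by (intro order_trans[OF norm_triangle_ineq]) (simp add: norm_mult)
      also have "\<dots> \<le> w powr (1 - b) / (b - 1) + w * w powr - b"
        using elim norm_cis_minus_one_le[of "w powr - b"]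
        by (intro add_mono norm_tail_exponent_le mult_left_mono) auto
      also have "w * w powr - b = w powr (1 - b)"
        using elim by (simp add: powr_diff powr_minus divide_simps)
      finally show ?case .
    qed
    have "((\<lambda>w. w powr (1 - b)) \<longlongrightarrow> 0) at_top"
      using b by (intro tendsto_neg_powr filterlim_ident) auto
    from tendsto_add[OF tendsto_divide[OF this tendsto_const[of "b - 1"]] this]
    show "((\<lambda>w. w powr (1 - b) / (b - 1) + w powr (1 - b)) \<longlongrightarrow> 0) at_top"
      using b by simp
  qed
  have S_der: "(S has_vector_derivative - \<i> * of_real (b * w powr - b) * cis (w powr - b)) (at w)" if "w > 0" for w
  proof -
    have 1: "((\<lambda>w. w powr - b) has_real_derivative - b * w powr (- b - 1)) (at w)"
      using that by (auto intro!: derivative_eq_intros)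
    have 2: "((\<lambda>w. cis (w powr - b)) has_vector_derivative (- b * w powr (- b - 1)) *\<^sub>R (\<i> * cis (w powr - b))) (at w)"
    proof -
      have "(cis has_vector_derivative \<i> * cis x) (at x)" for x
        unfolding has_vector_derivative_def by (auto intro!: derivative_eq_intros simp: scaleR_conv_of_real)
      from vector_diff_chain_at[OF 1[unfolded has_real_derivative_iff_has_vector_derivative] this]
      show ?thesis by (simp add: o_def)
    qed
    have "(S has_vector_derivative - (cis (w powr - b) - 1) +
       (of_real w * ((- b * w powr (- b - 1)) *\<^sub>R (\<i> * cis (w powr - b)) - 0) + of_real 1 * (cis (w powr - b) - 1))) (at w)"
      unfolding S_def
      by (intro has_vector_derivative_add tail_exponent_has_vector_derivative[OF that] has_vector_derivative_mult
          has_vector_derivative_diff 2 has_vector_derivative_const has_vector_derivative_of_real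
          DERIV_ident)
    also have "- (cis (w powr - b) - 1) +
       (of_real w * ((- b * w powr (- b - 1)) *\<^sub>R (\<i> * cis (w powr - b)) - 0) + of_real 1 * (cis (w powr - b) - 1))
       = - \<i> * of_real (b * (w * w powr (- b - 1))) * cis (w powr - b)"
      by (simp add: scaleR_conv_of_real algebra_simps)
    also have "w * w powr (- b - 1) = w powr - b"
      using that by (simp add: powr_diff)
    finally show ?thesis .
  qed
  have g_der: "((\<lambda>x. v * x powr (- 1 / b)) has_vector_derivative v * ((- 1 / b) * x powr (- 1 / b - 1))) (at x)"
    if "x > 0" for x
    unfolding has_real_derivative_iff_has_vector_derivative[symmetric]
    using that by (auto intro!: derivative_eq_intros)
  have g_pow: "(v * x powr (- 1 / b)) powr - b = v powr - b * x" if "x > 0" for x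
    using that v b by (simp add: powr_mult powr_powr)
  have R_der: "(R has_vector_derivative \<i> * of_real (v powr (1 - b)) * of_real (x powr (- 1 / b)) * cis (v powr - b * x)) (at x)"
    if x: "x > 0" for x
  proof -
    have pos: "v * x powr (- 1 / b) > 0" using v x by simp
    have "((S \<circ> (\<lambda>x. v * x powr (- 1 / b))) has_vector_derivative
      (v * ((- 1 / b) * x powr (- 1 / b - 1))) *\<^sub>R
      (- \<i> * of_real (b * (v * x powr (- 1 / b)) powr - b) * cis ((v * x powr (- 1 / b)) powr - b))) (at x)"
      by (rule vector_diff_chain_at[OF g_der[OF x] S_der[OF pos]])
    also have "(v * ((- 1 / b) * x powr (- 1 / b - 1))) *\<^sub>R
      (- \<i> * of_real (b * (v * x powr (- 1 / b)) powr - b) * cis ((v * x powr (- 1 / b)) powr - b))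
      = \<i> * of_real ((v * v powr - b) * (x * x powr (- 1 / b - 1))) * cis (v powr - b * x)"
      unfolding g_pow[OF x] using b by (simp add: scaleR_conv_of_real field_simps)
    also have "v * v powr - b = v powr (1 - b)" using v by (simp add: powr_diff powr_minus divide_simps)
    also have "x * x powr (- 1 / b - 1) = x powr (- 1 / b)" using x by (simp add: powr_diff)
    finally have "((\<lambda>x. S (v * x powr (- 1 / b))) has_vector_derivative
        \<i> * of_real (v powr (1 - b)) * of_real (x powr (- 1 / b)) * cis (v powr - b * x)) (at x)"
      by (simp add: o_def mult_ac)
    then show ?thesis
      by (rule has_vector_derivative_transform_within_open[of _ _ _ "{0<..}"])
         (use x in \<open>auto simp: R_def\<close>)
  qed
  have g_lim: "filterlim (\<lambda>x. v * x powr (- 1 / b)) at_top (at_right 0)"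
    using v b by real_asymp
  have "continuous_on {0..1} R"
    unfolding continuous_on_eq_continuous_within
  proof
    fix x :: real assume x: "x \<in> {0..1}"
    show "continuous (at x within {0..1}) R"
    proof (cases "x = 0")
      case True
      have "((\<lambda>x. S (v * x powr (- 1 / b))) \<longlongrightarrow> 0) (at_right 0)"
        by (rule filterlim_compose[OF S_lim g_lim])
      then have "(R \<longlongrightarrow> 0) (at_right 0)"
        by (rule Lim_transform_eventually)
           (auto simp: eventually_at_filter R_def)
      then have "(R \<longlongrightarrow> R 0) (at 0 within {0..1})"
        by (simp add: R_def at_within_Icc_at_right)
      with True show ?thesis by (simp add: continuous_within)
    next
      case False
      then have "isCont R x"
        using x R_der[of x] has_vector_derivative_continuous by auto
      then show ?thesis by (rule continuous_at_imp_continuous_at_within)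
    qed
  qed
  \<comment> \<open>The integrand is unbounded near \<open>0\<close>, so the version of the
    fundamental theorem is chosen that asks for continuity on \<open>{0..1}\<close> and for the
    derivative only in the interior.\<close>
  then have "((\<lambda>x. \<i> * of_real (v powr (1 - b)) * of_real (x powr (- 1 / b)) * cis (v powr - b * x))
      has_integral R 1 - R 0) {0..1}"
    by (intro fundamental_theorem_of_calculus_interior R_der) auto
  then show ?thesis by (simp add: R_def S_def)
qed

end

text \<open>As \<open>- 1 / b\<close> lies strictly between \<open>-1\<close> and \<open>0\<close>,
  one step of the recursion reaches the integral along the segment, which
  \<open>tail_exponent_by_parts\<close> evaluates. The term \<open>z powr s * exp (- z)\<close> of
  the recursion cancels the \<open>cis y\<close> left over there, and what remains is a multiple of
  \<open>full_exponent\<close>.\<close>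

lemma lower_gamma_eq_full_exponent:
  assumes b: "b > 1" and v: "v > 0"
  shows "lower_gamma (of_real (- 1 / b)) (- \<i> * of_real (v powr - b)) = of_real b * cis (pi / (2 * b)) * full_exponent b v"
proof -
  define y where "y = v powr - b"
  define s :: complex where "s = of_real (- 1 / b)"
  define z where "z = - \<i> * of_real y"
  have y: "y > 0" using v by (simp add: y_def)
  \<comment> \<open>On the principal branch the argument of \<open>- \<i>\<close> is
    \<open>- pi / 2\<close>; this is the source of the phase \<open>pi / (4 * c)\<close> in the
    theorem.\<close>
  have zs: "z powr s = of_real v * cis (pi / (2 * b))"
  proof -
    have "z powr s = (of_real y * (- \<i>)) powr s" by (simp add: z_def mult.commute)
    also have "\<dots> = of_real y powr s * (- \<i>) powr s"
      using y by (intro powr_times_real_left) auto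
    also have "of_real y powr s = of_real (y powr (- 1 / b))"
      unfolding s_def using y by (intro powr_of_real) auto
    also have "y powr (- 1 / b) = v" using v b by (simp add: y_def powr_powr)
    also have "(- \<i>) powr s = cis (pi / (2 * b))"
      by (simp add: powr_def s_def cis_conv_exp field_simps)
    finally show ?thesis .
  qed
  have vy: "v powr (1 - b) = v * y" using v by (simp add: y_def powr_diff powr_minus divide_simps)
  have eq: "(of_real x * z) powr s * exp (- (of_real x * z)) * z =
     - (z powr s) / of_real v * (\<i> * of_real (v powr (1 - b)) * of_real (x powr (- 1 / b)) * cis (y * x))"
    if "x \<in> {0..1}" for x
  proof -
    have "(of_real x * z) powr s = of_real x powr s * z powr s"
      using that by (intro powr_times_real_left) auto
    also have "of_real x powr s = of_real (x powr (- 1 / b))"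
      unfolding s_def using that by (intro powr_of_real) auto
    moreover have "exp (- (of_real x * z)) = cis (y * x)"
      by (simp add: z_def cis_conv_exp mult_ac)
    ultimately show ?thesis using v by (simp add: vy z_def)
  qed
  have "lower_gamma (s + 1) z = contour_integral (linepath 0 z) (\<lambda>u. u powr s * exp (- u))"
    using b by (subst lower_gamma.simps) (simp add: s_def)
  also have "\<dots> = integral {0..1} (\<lambda>x. (of_real x * z) powr s * exp (- (of_real x * z)) * z)"
    unfolding contour_integral_integral
    by (intro integral_cong) (simp add: linepath_def scaleR_conv_of_real)
  also have "\<dots> = - (z powr s) / of_real v * (tail_exponent b v + of_real v * (cis y - 1))"
  proof (rule integral_unique, rule has_integral_eq)
    show "((\<lambda>x. - (z powr s) / of_real v * (\<i> * of_real (v powr (1 - b)) * of_real (x powr (- 1 / b)) * cis (y * x)))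
      has_integral - (z powr s) / of_real v * (tail_exponent b v + of_real v * (cis y - 1))) {0..1}"
      using tail_exponent_by_parts[OF b v] unfolding y_def by (rule has_integral_mult_right)
  qed (simp add: eq)
  finally have 1: "lower_gamma (s + 1) z = \<dots>" .
  have "lower_gamma s z = (lower_gamma (s + 1) z + z powr s * exp (- z)) / s"
    using b by (subst lower_gamma.simps) (simp add: s_def)
  also have "exp (- z) = cis y" by (simp add: z_def cis_conv_exp mult_ac)
  also have "(lower_gamma (s + 1) z + z powr s * cis y) / s = of_real b * cis (pi / (2 * b)) * full_exponent b v"
    unfolding 1 zs using v b by (simp add: s_def full_exponent_def field_simps)
  finally show ?thesis by (simp add: s_def z_def y_def)
qed

section \<open>The characteristic function of the gap\<close>

context poisson_process
begin

definition gap :: "real \<Rightarrow> 'a \<Rightarrow> real" where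
  "gap b \<omega> = (\<Sum>j. T (Suc (Suc j)) \<omega> powr - b) - T 1 \<omega> powr - b"

lemma measurable_first [measurable]: "T 1 \<in> borel_measurable M"
  by (rule measurable_points) simp

lemma gap_measurable [measurable]: "gap b \<in> borel_measurable M"
  unfolding gap_def by measurable

lemma expectation_first_tail:
  assumes "a \<ge> 0"
  shows "expectation (\<lambda>\<omega>. of_bool (a < T 1 \<omega>) :: complex) = exp (of_real (- r * a))"
  using characteristic_functional[of "\<lambda>_. 0" a] assms by simp

text \<open>The void threshold \<open>a\<close> and the summation threshold \<open>x\<close> are
  kept apart so that a cell \<open>(a, x]\<close> for the first point arises as the difference of
  two instances, with \<open>a\<close> and with \<open>x\<close>, that share the second
  factor.\<close>

lemma tail_characteristic:
  assumes b: "b > 1" and s: "s > 0" and a: "0 \<le> a" "a \<le> x" and x: "0 < x"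
  shows "expectation (\<lambda>\<omega>. of_bool (a < T 1 \<omega>) *
      cis (\<Sum>j. if x < T (Suc j) \<omega> then (T (Suc j) \<omega> / s) powr - b else 0))
    = exp (of_real (- r * a)) * exp (of_real (r * s) * tail_exponent b (x / s))"
proof -
  define k where "k u = (if x < u then (u / s) powr - b else 0)" for u
  have k_eq: "k u = s powr b * (if x < u then u powr - b else 0)" for u
    using x s by (auto simp: k_def powr_divide powr_minus divide_simps)
  have "expectation (\<lambda>\<omega>. of_bool (a < T 1 \<omega>) * cis (\<Sum>j. k (T (Suc j) \<omega>)))
     = exp (of_real (- r * a)) * exp (of_real r * (LINT u|lborel. cis (k u) - 1))"
  proof (rule characteristic_functional)
    show "integrable lborel k"
      unfolding k_eq using tail_powr[OF b x] by (simp add: has_bochner_integral_iff)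
    show "AE \<omega> in M. summable (\<lambda>j. k (T (Suc j) \<omega>))"
      using AE_summable_powr[OF b]
    proof eventually_elim
      case (elim \<omega>)
      then have "summable (\<lambda>j. s powr b * T (Suc j) \<omega> powr - b)" by (rule summable_mult)
      then show ?case
        by (rule summable_comparison_test[rotated]) (auto simp: k_eq)
    qed
  qed (use a in \<open>auto simp: k_def\<close>)
  also have "(LINT u|lborel. cis (k u) - 1) = (LINT u|lborel. (if x < u then cis ((u / s) powr - b) - 1 else 0))"
    by (rule Bochner_Integration.integral_cong) (auto simp: k_def)
  also have "\<dots> = of_real s * tail_exponent b (x / s)" by (rule tail_exponent_scale[OF b s])
  finally show ?thesis by (simp add: k_def mult_ac)
qed

text \<open>The first point is rounded up to a grid of mesh \<open>1 / (n + 1)\<close>; on each grid cell the events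
  concerning the first point are independent of the points beyond the cell.\<close>

lemma characteristic_gap_first:
  assumes b: "b > 1" and s: "s > 0"
  shows "expectation (\<lambda>\<omega>. cis (s powr b * gap b \<omega>)) =
    expectation (\<lambda>\<omega>. cis (- ((T 1 \<omega> / s) powr - b)) * exp (of_real (r * s) * tail_exponent b (T 1 \<omega> / s)))"
proof -
  define h where "h u = (u / s) powr - b" for u
  define H where "H x = cis (- h x) * exp (of_real (r * s) * tail_exponent b (x / s))" for x
  define Y where "Y x \<omega> = (\<Sum>j. if x < T (Suc j) \<omega> then h (T (Suc j) \<omega>) else 0)" for x \<omega>
  \<comment> \<open>The phase produced by a first point at \<open>x\<close> together with the points
    beyond \<open>x\<close>, minus its mean \<open>H x\<close>.\<close>
  define D where "D x \<omega> = cis (Y x \<omega>) * cis (- h x) - H x" for x \<omega>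
  \<comment> \<open>The difference of truth values is the indicator of the cell
    \<open>(i - 1) / (n + 1) < T 1 <= i / (n + 1)\<close>; the cells with \<open>i\<close> up to
    \<open>n * (n + 1)\<close> fill \<open>(0, n]\<close>.\<close>
  define g where "g n \<omega> = (\<Sum>i\<in>{1..n * Suc n}.
      (of_bool (real (i - 1) / real (Suc n) < T 1 \<omega>) - of_bool (real i / real (Suc n) < T 1 \<omega>))
        * D (real i / real (Suc n)) \<omega>)" for n \<omega>
  have [measurable]: "h \<in> borel_measurable borel" "H \<in> borel_measurable borel"
    unfolding h_def H_def by measurable
  have [measurable]: "Y x \<in> borel_measurable M" "D x \<in> borel_measurable M" for x
    unfolding D_def Y_def by measurable
  have g_meas[measurable]: "g n \<in> borel_measurable M" for n
    unfolding g_def by measurable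
  have nH: "norm (H x) \<le> 1" if "x > 0" for x
  proof -
    have "Re (of_real (r * s) * tail_exponent b (x / s)) \<le> 0"
      using Re_tail_exponent_nonpos[OF b, of "x / s"] that s intensity_pos by (simp add: mult_nonneg_nonpos)
    then show ?thesis by (simp add: H_def norm_mult)
  qed
  have nD: "norm (D x \<omega>) \<le> 2" if "x > 0" for x \<omega>
    using norm_triangle_ineq4[of "cis (Y x \<omega>) * cis (- h x)" "H x"] nH[OF that]
    by (simp add: D_def norm_mult)
  \<comment> \<open>Because of the shared factor, the phase contributes the probability of the cell
    times \<open>H x\<close>, which is exactly what the subtracted mean contributes.\<close>
  have cell: "expectation (\<lambda>\<omega>. (of_bool (a < T 1 \<omega>) - of_bool (x < T 1 \<omega>)) * D x \<omega>) = 0"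
    if "0 \<le> a" "a \<le> x" "0 < x" for a x
  proof -
    have int1: "integrable M (\<lambda>\<omega>. of_bool (c < T 1 \<omega>) * cis (Y x \<omega>))" for c
      by (rule integrable_const_bound[where B=1]) (auto simp: norm_mult)
    have int2: "integrable M (\<lambda>\<omega>. of_bool (c < T 1 \<omega>) :: complex)" for c
      by (rule integrable_const_bound[where B=1]) auto
    have "expectation (\<lambda>\<omega>. (of_bool (a < T 1 \<omega>) - of_bool (x < T 1 \<omega>)) * D x \<omega>)
      = expectation (\<lambda>\<omega>. (of_bool (a < T 1 \<omega>) * cis (Y x \<omega>) - of_bool (x < T 1 \<omega>) * cis (Y x \<omega>)) * cis (- h x)
          - (of_bool (a < T 1 \<omega>) - of_bool (x < T 1 \<omega>)) * H x)"
      by (intro Bochner_Integration.integral_cong) (auto simp: D_def algebra_simps)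
    also have "\<dots> = (expectation (\<lambda>\<omega>. of_bool (a < T 1 \<omega>) * cis (Y x \<omega>))
          - expectation (\<lambda>\<omega>. of_bool (x < T 1 \<omega>) * cis (Y x \<omega>))) * cis (- h x)
          - (expectation (\<lambda>\<omega>. of_bool (a < T 1 \<omega>)) - expectation (\<lambda>\<omega>. of_bool (x < T 1 \<omega>))) * H x"
      using int1 int2 by simp
    also have "expectation (\<lambda>\<omega>. of_bool (a < T 1 \<omega>) * cis (Y x \<omega>))
        = exp (of_real (- r * a)) * exp (of_real (r * s) * tail_exponent b (x / s))"
      unfolding Y_def h_def by (rule tail_characteristic[OF b s that])
    also have "expectation (\<lambda>\<omega>. of_bool (x < T 1 \<omega>) * cis (Y x \<omega>))
        = exp (of_real (- r * x)) * exp (of_real (r * s) * tail_exponent b (x / s))"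
      unfolding Y_def h_def using that by (intro tail_characteristic[OF b s]) auto
    also have "expectation (\<lambda>\<omega>. of_bool (a < T 1 \<omega>) :: complex) = exp (of_real (- r * a))"
      using that by (intro expectation_first_tail)
    also have "expectation (\<lambda>\<omega>. of_bool (x < T 1 \<omega>) :: complex) = exp (of_real (- r * x))"
      using that by (intro expectation_first_tail) auto
    finally have "expectation (\<lambda>\<omega>. (of_bool (a < T 1 \<omega>) - of_bool (x < T 1 \<omega>)) * D x \<omega>) = 0"
      by (simp add: H_def algebra_simps)
    then show ?thesis .
  qed
  have Eg: "expectation (g n) = 0" for n
  proof -
    have "expectation (g n) = (\<Sum>i\<in>{1..n * Suc n}. expectation (\<lambda>\<omega>.
      (of_bool (real (i - 1) / real (Suc n) < T 1 \<omega>) - of_bool (real i / real (Suc n) < T 1 \<omega>))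
        * D (real i / real (Suc n)) \<omega>))"
      unfolding g_def
    proof (rule Bochner_Integration.integral_sum)
      fix i assume i: "i \<in> {1..n * Suc n}"
      show "integrable M (\<lambda>\<omega>. (of_bool (real (i - 1) / real (Suc n) < T 1 \<omega>)
          - of_bool (real i / real (Suc n) < T 1 \<omega>)) * D (real i / real (Suc n)) \<omega>)"
      proof (rule integrable_const_bound[where B=2])
        show "AE \<omega> in M. norm ((of_bool (real (i - 1) / real (Suc n) < T 1 \<omega>)
          - of_bool (real i / real (Suc n) < T 1 \<omega>)) * D (real i / real (Suc n)) \<omega>) \<le> 2"
          using i nD[of "real i / real (Suc n)"] by (auto simp: norm_mult intro!: AE_I2)
      qed measurable
    qed
    also have "\<dots> = 0"
      by (intro sum.neutral ballI cell) (auto intro!: divide_right_mono)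
    finally show ?thesis .
  qed
  \<comment> \<open>Rounding up rather than down removes the first point itself from
    \<open>Y\<close>, where the comparison with the threshold is strict.\<close>
  define R where "R n \<omega> = real_of_int \<lceil>real (Suc n) * T 1 \<omega>\<rceil> / real (Suc n)" for n \<omega>
  have R: "T 1 \<omega> \<le> R n \<omega>" "R n \<omega> \<le> T 1 \<omega> + 1 / real (Suc n)" for n \<omega>
  proof -
    have "real (Suc n) * T 1 \<omega> \<le> real_of_int \<lceil>real (Suc n) * T 1 \<omega>\<rceil>" by (rule le_of_int_ceiling)
    then show "T 1 \<omega> \<le> R n \<omega>"
      unfolding R_def by (subst pos_le_divide_eq) (simp_all add: mult.commute del: of_nat_Suc)
    have "R n \<omega> \<le> (real (Suc n) * T 1 \<omega> + 1) / real (Suc n)"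
      unfolding R_def by (intro divide_right_mono of_int_ceiling_le_add_one) simp
    also have "\<dots> = T 1 \<omega> + 1 / real (Suc n)"
      by (simp add: add_divide_distrib del: of_nat_Suc)
    finally show "R n \<omega> \<le> T 1 \<omega> + 1 / real (Suc n)" .
  qed
  have g_eq: "g n \<omega> = of_bool (T 1 \<omega> \<le> real n) * D (R n \<omega>) \<omega>" if "\<omega> \<in> space M" for n \<omega>
  proof -
    define m where "m = nat \<lceil>real (Suc n) * T 1 \<omega>\<rceil>"
    have pos: "real (Suc n) * T 1 \<omega> > 0" using points_pos[OF that] by simp
    then have m: "real m = real_of_int \<lceil>real (Suc n) * T 1 \<omega>\<rceil>" "m \<ge> 1"
      by (simp_all add: m_def) linarith
    have "g n \<omega> = (\<Sum>i\<in>{1..n * Suc n}. if m = i then D (real i / real (Suc n)) \<omega> else 0)"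
      unfolding g_def
    proof (intro sum.cong refl)
      fix i assume i: "i \<in> {1..n * Suc n}"
      have e: "(real i / real (Suc n) < T 1 \<omega>) = (real i < real (Suc n) * T 1 \<omega>)" for i
        by (simp add: field_simps)
      have "real (i - 1) < real (Suc n) * T 1 \<omega> \<longleftrightarrow> i \<le> m" "real i < real (Suc n) * T 1 \<omega> \<longleftrightarrow> i < m"
        using i m by (simp_all add: of_nat_diff) linarith+
      then show "(of_bool (real (i - 1) / real (Suc n) < T 1 \<omega>) - of_bool (real i / real (Suc n) < T 1 \<omega>))
        * D (real i / real (Suc n)) \<omega> = (if m = i then D (real i / real (Suc n)) \<omega> else 0)"
        unfolding e by auto
    qed
    also have "\<dots> = of_bool (m \<le> n * Suc n) * D (R n \<omega>) \<omega>"
      using m(2) by (auto simp: R_def m(1))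
    also have "m \<le> n * Suc n \<longleftrightarrow> T 1 \<omega> \<le> real n"
    proof -
      have "m \<le> n * Suc n \<longleftrightarrow> real (Suc n) * T 1 \<omega> \<le> real (n * Suc n)"
        using m(1) by linarith
      also have "\<dots> \<longleftrightarrow> T 1 \<omega> \<le> real n"
        unfolding of_nat_mult by (subst mult.commute) (simp del: of_nat_Suc)
      finally show ?thesis .
    qed
    finally show ?thesis .
  qed
  have "(\<lambda>n. expectation (g n)) \<longlonglongrightarrow> expectation (\<lambda>\<omega>. cis (s powr b * gap b \<omega>) - H (T 1 \<omega>))"
  proof (rule integral_dominated_convergence[where w="\<lambda>_. 2"])
    show "AE \<omega> in M. norm (g n \<omega>) \<le> 2" for n
    proof (rule AE_I2)
      fix \<omega> assume w: "\<omega> \<in> space M"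
      show "norm (g n \<omega>) \<le> 2"
        using nD[of "R n \<omega>" \<omega>] R(1)[of \<omega> n] points_pos[OF w] by (simp add: g_eq[OF w])
    qed
    show "AE \<omega> in M. (\<lambda>n. g n \<omega>) \<longlonglongrightarrow> cis (s powr b * gap b \<omega>) - H (T 1 \<omega>)"
      using AE_summable_powr[OF b] AE_space
    proof eventually_elim
      fix \<omega> assume summ: "summable (\<lambda>j. T (Suc j) \<omega> powr - b)" and w: "\<omega> \<in> space M"
      have pos: "T (Suc j) \<omega> > 0" for j using point_pos[OF w] by simp
      have h_eq: "h (T (Suc j) \<omega>) = s powr b * T (Suc j) \<omega> powr - b" for j
        using pos[of j] s by (simp add: h_def powr_divide powr_minus divide_simps)
      have summh: "summable (\<lambda>j. h (T (Suc j) \<omega>))"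
        unfolding h_eq by (rule summable_mult[OF summ])
      have lim: "(\<lambda>n. R n \<omega>) \<longlonglongrightarrow> T 1 \<omega>"
      proof (rule tendsto_sandwich[OF _ _ tendsto_const])
        show "(\<lambda>n. T 1 \<omega> + 1 / real (Suc n)) \<longlonglongrightarrow> T 1 \<omega>"
          using tendsto_add[OF tendsto_const lim_1_over_n[THEN LIMSEQ_Suc], of "T 1 \<omega>"] by simp
      qed (use R in auto)
      have Zs: "s powr b * gap b \<omega> = (\<Sum>j. h (T (Suc (Suc j)) \<omega>)) + - h (T 1 \<omega>)"
      proof -
        have "summable (\<lambda>j. T (Suc (Suc j)) \<omega> powr - b)"
          using summ by (subst summable_Suc_iff)
        then show ?thesis
          using h_eq[of 0] by (simp add: gap_def h_eq suminf_mult right_diff_distrib)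
      qed
      \<comment> \<open>The first two points differ, so a fine grid separates them and the rounding
        loses no later point.\<close>
      have "T 1 \<omega> < T 2 \<omega>" using points_increasing[OF w, of 1] by (simp add: numeral_2_eq_2)
      then have "eventually (\<lambda>n. R n \<omega> < T 2 \<omega>) sequentially"
        using lim by (simp add: order_tendsto_iff)
      then have YR: "eventually (\<lambda>n. Y (R n \<omega>) \<omega> = (\<Sum>j. h (T (Suc (Suc j)) \<omega>))) sequentially"
      proof eventually_elim
        case (elim n)
        let ?f = "\<lambda>j. if R n \<omega> < T (Suc j) \<omega> then h (T (Suc j) \<omega>) else 0"
        have "summable ?f"
          by (rule summable_comparison_test[OF _ summh]) (auto simp: h_def)
        then have "Y (R n \<omega>) \<omega> = ?f 0 + (\<Sum>j. ?f (Suc j))"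
          unfolding Y_def by (subst suminf_split_head) auto
        also have "?f 0 = 0" using R(1)[of \<omega> n] by simp
        also have "(\<lambda>j. ?f (Suc j)) = (\<lambda>j. h (T (Suc (Suc j)) \<omega>))"
        proof
          fix j have "T 2 \<omega> \<le> T (Suc (Suc j)) \<omega>" by (rule points_mono[OF w]) auto
          then show "?f (Suc j) = h (T (Suc (Suc j)) \<omega>)" using elim by simp
        qed
        finally show ?case by simp
      qed
      have hc: "(\<lambda>n. h (R n \<omega>)) \<longlonglongrightarrow> h (T 1 \<omega>)"
        unfolding h_def using lim pos[of 0] s by (auto intro!: tendsto_intros)
      have "isCont (tail_exponent b) (T 1 \<omega> / s)" using isCont_tail_exponent[OF b] pos[of 0] s by simp
      then have "(\<lambda>n. tail_exponent b (R n \<omega> / s)) \<longlonglongrightarrow> tail_exponent b (T 1 \<omega> / s)"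
        by (rule isCont_tendsto_compose) (use lim s in \<open>auto intro!: tendsto_intros\<close>)
      then have Hc: "(\<lambda>n. H (R n \<omega>)) \<longlonglongrightarrow> H (T 1 \<omega>)"
        unfolding H_def by (intro tendsto_intros hc)
      have "(\<lambda>n. cis (\<Sum>j. h (T (Suc (Suc j)) \<omega>)) * cis (- h (R n \<omega>)) - H (R n \<omega>))
         \<longlonglongrightarrow> cis (\<Sum>j. h (T (Suc (Suc j)) \<omega>)) * cis (- h (T 1 \<omega>)) - H (T 1 \<omega>)"
        by (intro tendsto_intros hc Hc)
      also have "cis (\<Sum>j. h (T (Suc (Suc j)) \<omega>)) * cis (- h (T 1 \<omega>)) = cis (s powr b * gap b \<omega>)"
        by (simp only: Zs cis_mult)
      finally show "(\<lambda>n. g n \<omega>) \<longlonglongrightarrow> cis (s powr b * gap b \<omega>) - H (T 1 \<omega>)"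
      proof (rule Lim_transform_eventually)
        show "eventually (\<lambda>n. cis (\<Sum>j. h (T (Suc (Suc j)) \<omega>)) * cis (- h (R n \<omega>)) - H (R n \<omega>) = g n \<omega>) sequentially"
          using YR eventually_ge_at_top[of "nat \<lceil>T 1 \<omega>\<rceil>"]
        proof eventually_elim
          case (elim n)
          then have "T 1 \<omega> \<le> real n" by linarith
          then show ?case using elim by (simp add: g_eq[OF w] D_def)
        qed
      qed
    qed
  qed auto
  then have "expectation (\<lambda>\<omega>. cis (s powr b * gap b \<omega>) - H (T 1 \<omega>)) = 0"
    by (simp add: Eg LIMSEQ_const_iff)
  moreover have "expectation (\<lambda>\<omega>. cis (s powr b * gap b \<omega>) - H (T 1 \<omega>))
      = expectation (\<lambda>\<omega>. cis (s powr b * gap b \<omega>)) - expectation (\<lambda>\<omega>. H (T 1 \<omega>))"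
  proof (rule Bochner_Integration.integral_diff)
    show "integrable M (\<lambda>\<omega>. cis (s powr b * gap b \<omega>))"
      by (rule integrable_const_bound[where B=1]) auto
    show "integrable M (\<lambda>\<omega>. H (T 1 \<omega>))"
      using points_pos nH by (intro integrable_const_bound[where B=1] AE_I2) auto
  qed
  ultimately show ?thesis by (simp add: H_def h_def)
qed

text \<open>The first point has density \<open>r * exp (- r * x)\<close>. Substituting
  \<open>x = s * v\<close> frees the phase \<open>v powr - b\<close> of \<open>s\<close>, which is
  left only in the prefactor and linearly in the exponent; this is why the argument is taken to be
  \<open>s powr b\<close>.\<close>

lemma characteristic_gap:
  assumes b: "b > 1" and s: "s > 0"
  shows "expectation (\<lambda>\<omega>. cis (s powr b * gap b \<omega>)) =
    of_real (r * s) * (LINT v:{0<..}|lborel. exp (of_real (r * s) * full_exponent b v) * cis (- (v powr - b)))"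
proof -
  define H where "H x = cis (- ((x / s) powr - b)) * exp (of_real (r * s) * tail_exponent b (x / s))" for x
  have [measurable]: "H \<in> borel_measurable borel"
    unfolding H_def by measurable
  have D: "distr M lborel (T 1) = density lborel (\<lambda>x. ennreal (exponential_density r x))"
    by (rule distributed_distr_eq_density[OF first_point_distributed])
  have "expectation (\<lambda>\<omega>. H (T 1 \<omega>)) = integral\<^sup>L (distr M lborel (T 1)) H"
    by (subst integral_distr) auto
  also have "\<dots> = (LINT x|lborel. exponential_density r x *\<^sub>R H x)"
    unfolding D using intensity_pos by (subst integral_density) (auto simp: exponential_density_nonneg)
  also have "\<dots> = \<bar>s\<bar> *\<^sub>R (LINT v|lborel. exponential_density r (0 + s * v) *\<^sub>R H (0 + s * v))"
    using s by (intro lborel_integral_real_affine) auto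
  also have "\<dots> = s *\<^sub>R (LINT v|lborel. of_real r * (indicator {0<..} v *\<^sub>R
      (exp (of_real (r * s) * full_exponent b v) * cis (- (v powr - b)))))"
  proof -
    have "AE v in lborel. exponential_density r (0 + s * v) *\<^sub>R H (0 + s * v) =
      of_real r * (indicator {0<..} v *\<^sub>R (exp (of_real (r * s) * full_exponent b v) * cis (- (v powr - b))))"
      using AE_lborel_singleton[of 0]
    proof eventually_elim
      case (elim v)
      show ?case
      proof (cases "v > 0")
        case True
        have "exp (of_real (r * s) * full_exponent b v) = of_real (exp (- (r * s * v))) * exp (of_real (r * s) * tail_exponent b v)"
          by (simp add: full_exponent_def exp_of_real[symmetric] exp_add[symmetric] algebra_simps)
        then show ?thesis using True s
          by (simp add: exponential_density_def H_def scaleR_conv_of_real mult_ac mult_less_0_iff)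
      next
        case False
        with elim have "v < 0" by simp
        then show ?thesis using s by (simp add: exponential_density_def mult_pos_neg)
      qed
    qed
    then have "(LINT v|lborel. exponential_density r (0 + s * v) *\<^sub>R H (0 + s * v)) =
      (LINT v|lborel. of_real r * (indicator {0<..} v *\<^sub>R (exp (of_real (r * s) * full_exponent b v) * cis (- (v powr - b)))))"
      by (intro integral_cong_AE) auto
    then show ?thesis using s by simp
  qed
  finally show ?thesis
    using characteristic_gap_first[OF b s]
    by (simp add: H_def set_lebesgue_integral_def scaleR_conv_of_real)
qed

end

section \<open>Inversion\<close>

lemma exp_minus_integrable:
  assumes "a > 0"
  shows "has_bochner_integral lborel (\<lambda>x. if 0 < x then exp (- a * x) else 0 :: real) (1 / a)"
proof -
  have "((\<lambda>x. exp (- a * x)) has_integral exp (- a * 0) / a) {0..}"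
    using assms by (intro has_integral_exp_minus_to_infinity)
  then have "((\<lambda>x. if x \<in> {0..} then exp (- a * x) else 0) has_integral 1 / a) UNIV"
    by (subst has_integral_restrict_UNIV) simp
  then have "has_bochner_integral lborel (\<lambda>x. if x \<in> {0..} then exp (- a * x) else 0) (1 / a)"
    using assms by (intro has_bochner_integral_nn_integral nn_integral_has_integral_lborel) auto
  moreover have ae: "AE x in lborel. (if x \<in> {0..} then exp (- a * x) else 0) = (if 0 < x then exp (- a * x) else 0)"
    using AE_lborel_singleton[of 0] by eventually_elim auto
  ultimately show ?thesis
    using has_bochner_integral_cong_AE[OF _ _ ae, of "1 / a"] by simp
qed

lemma integral_exp_half_line:
  fixes w :: complex
  assumes w: "Re w < 0"
  shows "(LINT s:{0<..}|lborel. exp (of_real s * w)) = - 1 / w"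
    and "set_integrable lborel {0<..} (\<lambda>s. exp (of_real s * w))"
proof -
  have int: "has_bochner_integral lborel (\<lambda>x. if 0 < x then exp (- (- Re w) * x) else 0) (1 / (- Re w))"
    using w by (intro exp_minus_integrable) auto
  show si: "set_integrable lborel {0<..} (\<lambda>s. exp (of_real s * w))"
    unfolding set_integrable_def
  proof (rule Bochner_Integration.integrable_bound)
    show "integrable lborel (\<lambda>x. if 0 < x then exp (- (- Re w) * x) else 0)"
      using int by (simp add: has_bochner_integral_iff)
    show "AE x in lborel. norm (indicat_real {0<..} x *\<^sub>R exp (of_real x * w))
        \<le> norm (if 0 < x then exp (- (- Re w) * x) else 0)"
      by (auto intro!: AE_I2 simp: mult.commute)
  qed measurable
  have w0: "w \<noteq> 0" using w by auto
  have "(LBINT s=0..\<infinity>. exp (of_real s * w)) = 0 - 1 / w"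
  proof (rule interval_integral_FTC_integrable[where F="\<lambda>s. exp (of_real s * w) / w"])
    show "((\<lambda>s. exp (of_real s * w) / w) has_vector_derivative exp (of_real x * w)) (at x)" for x
      by (rule has_vector_derivative_real_field[where f="\<lambda>z. exp (z * w) / w"])
         (use w0 in \<open>auto intro!: derivative_eq_intros\<close>)
    have "isCont (\<lambda>s::real. exp (of_real s * w) / w) 0"
      using w0 by (intro continuous_intros) auto
    then have "((\<lambda>s::real. exp (of_real s * w) / w) \<longlongrightarrow> 1 / w) (at_right 0)"
      by (simp add: continuous_within isCont_def filterlim_at_split)
    then show "(((\<lambda>s. exp (of_real s * w) / w) \<circ> real_of_ereal) \<longlongrightarrow> 1 / w) (at_right 0)"
      unfolding zero_ereal_def by (simp add: ereal_tendsto_simps)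
    have "((\<lambda>s::real. norm (exp (of_real s * w))) \<longlongrightarrow> 0) at_top"
      using w by (simp add: norm_exp_eq_Re) real_asymp
    then have "((\<lambda>s::real. exp (of_real s * w)) \<longlongrightarrow> 0) at_top"
      by (rule tendsto_norm_zero_cancel)
    from tendsto_divide[OF this tendsto_const w0]
    show "(((\<lambda>s. exp (of_real s * w) / w) \<circ> real_of_ereal) \<longlongrightarrow> 0) (at_left \<infinity>)"
      by (simp add: ereal_tendsto_simps)
    show "set_integrable lborel (einterval 0 \<infinity>) (\<lambda>s. exp (of_real s * w))"
      using si by (simp add: zero_ereal_def)
  qed (auto intro!: continuous_intros)
  then show "(LINT s:{0<..}|lborel. exp (of_real s * w)) = - 1 / w"
    by (simp add: interval_lebesgue_integral_0_infty)
qed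

text \<open>The factor \<open>r * s\<close> of the characteristic function stays outside, because
  its \<open>s\<close> cancels against the weight \<open>1 / s\<close> of the inversion
  formula.\<close>

definition gap_kernel :: "real \<Rightarrow> real \<Rightarrow> real \<Rightarrow> real \<Rightarrow> complex" where
  "gap_kernel b r s v = exp (of_real (r * s) * full_exponent b v) * cis (- (v powr - b))"

context
  fixes b r :: real
  assumes b: "b > 1" and r: "r > 0"
begin

lemma gap_kernel_measurable [measurable]: "(\<lambda>(s, v). gap_kernel b r s v) \<in> borel_measurable (borel \<Otimes>\<^sub>M borel)"
  unfolding gap_kernel_def by measurable

text \<open>For \<open>v >= 1\<close> the imaginary part is the modulus times the sine of
  \<open>r * s * Im (full_exponent b v) - v powr - b\<close>. Here
  \<open>Im (full_exponent b v)\<close> is at most \<open>v powr (1 - b) / (b - 1)\<close> in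
  absolute value, and the surplus factor \<open>s * v\<close> over \<open>v powr - b\<close> is
  absorbed by the exponential. The resulting decay in \<open>v\<close> is uniform in
  \<open>s\<close>, unlike that of the modulus.\<close>

lemma gap_kernel_bounds:
  "\<exists>a>0. \<exists>C>0. \<forall>s>0. \<forall>v>0. norm (gap_kernel b r s v) \<le> exp (- a * s) * exp (- a * s * v) \<and>
      \<bar>Im (gap_kernel b r s v)\<bar> \<le> C * exp (- a * s) * (if v < 1 then 1 else v powr - b)"
proof -
  obtain d where d: "d > 0" "\<And>v. v > 0 \<Longrightarrow> Re (full_exponent b v) \<le> - d * (1 + v)"
    using Re_full_exponent_le[OF b] by blast
  \<comment> \<open>The fraction pays for \<open>r * s * v powr (1 - b) / (b - 1)\<close>, which is
    \<open>v powr - b * x / (d * (b - 1))\<close> with \<open>x = r * d * s * v\<close>, using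
    \<open>x * exp (- x) <= 1\<close>. The \<open>1\<close> pays for the phase
    \<open>v powr - b\<close> and for the case \<open>v < 1\<close>.\<close>
  define C where "C = 1 + 1 / (d * (b - 1))"
  have C: "C \<ge> 1" using d b by (simp add: C_def)
  have N: "norm (gap_kernel b r s v) = exp (r * s * Re (full_exponent b v))" for s v
    by (simp add: gap_kernel_def norm_mult norm_exp_eq_Re)
  have E: "exp (r * s * Re (full_exponent b v)) \<le> exp (- (r * d) * s) * exp (- (r * d) * s * v)" if "s > 0" "v > 0" for s v
  proof -
    have "r * s * Re (full_exponent b v) \<le> r * s * (- d * (1 + v))"
      using that r d by (intro mult_left_mono) auto
    then show ?thesis by (simp add: exp_add[symmetric] algebra_simps)
  qed
  have I: "\<bar>Im (gap_kernel b r s v)\<bar> \<le> C * exp (- (r * d) * s) * (if v < 1 then 1 else v powr - b)" if sv: "s > 0" "v > 0" for s v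
  proof (cases "v < 1")
    case True
    have "\<bar>Im (gap_kernel b r s v)\<bar> \<le> norm (gap_kernel b r s v)" by (rule abs_Im_le_cmod)
    also have "\<dots> \<le> exp (- (r * d) * s) * exp (- (r * d) * s * v)" using E[OF sv] by (simp add: N)
    also have "\<dots> \<le> C * exp (- (r * d) * s)"
    proof -
      have "exp (- (r * d) * s * v) \<le> 1" using sv r d by simp
      from order_trans[OF this C]
      have "exp (- (r * d) * s) * exp (- (r * d) * s * v) \<le> exp (- (r * d) * s) * C"
        by (intro mult_left_mono) auto
      then show ?thesis by (simp add: mult.commute)
    qed
    finally show ?thesis using True by simp
  next
    case False
    have e: "exp (of_real (r * s) * full_exponent b v) = of_real (exp (r * s * Re (full_exponent b v))) * cis (r * s * Im (full_exponent b v))"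
      by (subst exp_eq_polar) simp
    have "Im (gap_kernel b r s v) = exp (r * s * Re (full_exponent b v)) * sin (r * s * Im (full_exponent b v) - v powr - b)"
      unfolding gap_kernel_def e mult.assoc cis_mult by simp
    then have "\<bar>Im (gap_kernel b r s v)\<bar> = exp (r * s * Re (full_exponent b v)) * \<bar>sin (r * s * Im (full_exponent b v) - v powr - b)\<bar>"
      by (simp add: abs_mult)
    also have "\<dots> \<le> (exp (- (r * d) * s) * exp (- (r * d) * s * v)) * (r * s * (v powr (1 - b) / (b - 1)) + v powr - b)"
    proof (intro mult_mono E sv)
      have "\<bar>sin (r * s * Im (full_exponent b v) - v powr - b)\<bar> \<le> \<bar>r * s * Im (full_exponent b v) - v powr - b\<bar>"
        by (rule abs_sin_x_le_abs_x)
      also have "\<dots> \<le> r * s * \<bar>Im (full_exponent b v)\<bar> + v powr - b"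
        using r sv by (intro order_trans[OF abs_triangle_ineq4]) (simp add: abs_mult)
      also have "\<bar>Im (full_exponent b v)\<bar> \<le> v powr (1 - b) / (b - 1)"
        using norm_tail_exponent_le[OF b sv(2)] abs_Im_le_cmod[of "tail_exponent b v"] by (simp add: full_exponent_def)
      finally show "\<bar>sin (r * s * Im (full_exponent b v) - v powr - b)\<bar> \<le> r * s * (v powr (1 - b) / (b - 1)) + v powr - b"
        using r sv by (simp add: mult_left_mono)
    qed auto
    also have "\<dots> = exp (- (r * d) * s) * v powr - b *
        ((r * d * s * v * exp (- (r * d * s * v))) / (d * (b - 1)) + exp (- (r * d * s * v)))"
      using sv d b by (simp add: powr_diff powr_minus field_simps)
    also have "\<dots> \<le> exp (- (r * d) * s) * v powr - b * C"
    proof -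
      have x: "x * exp (- x) \<le> 1" for x :: real
      proof -
        have "x \<le> exp x" using exp_ge_add_one_self[of x] by linarith
        then show ?thesis by (simp add: exp_minus field_simps)
      qed
      have "(r * d * s * v * exp (- (r * d * s * v))) / (d * (b - 1)) \<le> 1 / (d * (b - 1))"
        using x[of "r * d * s * v"] d b by (intro divide_right_mono) auto
      moreover have "exp (- (r * d * s * v)) \<le> 1" using sv r d by simp
      ultimately have "(r * d * s * v * exp (- (r * d * s * v))) / (d * (b - 1)) + exp (- (r * d * s * v)) \<le> C"
        unfolding C_def by linarith
      then show ?thesis by (intro mult_left_mono) auto
    qed
    finally show ?thesis using False by (simp add: mult_ac)
  qed
  show ?thesis
    using E I r d C by (intro exI[of _ "r * d"] conjI exI[of _ C]) (auto simp: N)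
qed

lemma gap_kernel_integrable:
  assumes s: "s > 0"
  shows "set_integrable lborel {0<..} (gap_kernel b r s)"
proof -
  obtain a C where a: "a > 0" "\<And>s v. s > 0 \<Longrightarrow> v > 0 \<Longrightarrow> norm (gap_kernel b r s v) \<le> exp (- a * s) * exp (- a * s * v)"
    using gap_kernel_bounds by blast
  have h: "has_bochner_integral lborel (\<lambda>v. if 0 < v then exp (- (a * s) * v) else 0) (1 / (a * s))"
    using a s by (intro exp_minus_integrable) auto
  show ?thesis
    unfolding set_integrable_def
  proof (rule Bochner_Integration.integrable_bound)
    show "integrable lborel (\<lambda>v. exp (- a * s) * (if 0 < v then exp (- (a * s) * v) else 0))"
      using h by (intro integrable_mult_right) (simp add: has_bochner_integral_iff)
    show "AE v in lborel. norm (indicat_real {0<..} v *\<^sub>R gap_kernel b r s v) \<le> norm (exp (- a * s) * (if 0 < v then exp (- (a * s) * v) else 0))"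
      using a(2)[OF s] by (auto intro!: AE_I2)
  qed measurable
qed

text \<open>Integrating the modulus bound over \<open>v\<close> costs \<open>1 / (a * s)\<close>,
  which the prefactor \<open>r * s\<close> compensates; \<open>exp (- a * s)\<close> survives. This
  is the decay of the characteristic function that rules out an atom.\<close>

lemma integral_gap_kernel_tendsto_0:
  "((\<lambda>s. of_real (r * s) * (LINT v:{0<..}|lborel. gap_kernel b r s v)) \<longlongrightarrow> 0) at_top"
proof -
  obtain a C where a: "a > 0" "\<And>s v. s > 0 \<Longrightarrow> v > 0 \<Longrightarrow> norm (gap_kernel b r s v) \<le> exp (- a * s) * exp (- a * s * v)"
    using gap_kernel_bounds by blast
  have B: "norm (of_real (r * s) * (LINT v:{0<..}|lborel. gap_kernel b r s v)) \<le> (r / a) * exp (- a * s)" if s: "s > 0" for s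
  proof -
    have h: "has_bochner_integral lborel (\<lambda>v. if 0 < v then exp (- (a * s) * v) else 0) (1 / (a * s))"
      using a s by (intro exp_minus_integrable) auto
    have "norm (LINT v:{0<..}|lborel. gap_kernel b r s v) \<le> (LINT v|lborel. norm (indicat_real {0<..} v *\<^sub>R gap_kernel b r s v))"
      unfolding set_lebesgue_integral_def by (rule integral_norm_bound)
    also have "\<dots> \<le> (LINT v|lborel. exp (- a * s) * (if 0 < v then exp (- (a * s) * v) else 0))"
    proof (rule Bochner_Integration.integral_mono)
      show "integrable lborel (\<lambda>v. norm (indicat_real {0<..} v *\<^sub>R gap_kernel b r s v))"
        using gap_kernel_integrable[OF s] unfolding set_integrable_def by (rule integrable_norm)
      show "integrable lborel (\<lambda>v. exp (- a * s) * (if 0 < v then exp (- (a * s) * v) else 0))"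
        using h by (intro integrable_mult_right) (simp add: has_bochner_integral_iff)
    qed (use a(2)[OF s] in auto)
    also have "\<dots> = exp (- a * s) * (1 / (a * s))"
      using h by (simp add: has_bochner_integral_iff)
    finally have "r * s * norm (LINT v:{0<..}|lborel. gap_kernel b r s v) \<le> r * s * (exp (- a * s) * (1 / (a * s)))"
      using r s by (intro mult_left_mono) auto
    then show ?thesis using r s by (simp add: norm_mult)
  qed
  show ?thesis
  proof (rule Lim_null_comparison)
    show "eventually (\<lambda>s. norm (of_real (r * s) * (LINT v:{0<..}|lborel. gap_kernel b r s v)) \<le> (r / a) * exp (- a * s)) at_top"
      using eventually_gt_at_top[of 0] by eventually_elim (rule B)
    show "((\<lambda>s. (r / a) * exp (- a * s)) \<longlongrightarrow> 0) at_top"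
      using a(1) by real_asymp
  qed
qed

text \<open>The bound on the imaginary part is a product of a function of \<open>s\<close> and a
  function of \<open>v\<close>, both integrable on the half-line since \<open>b > 1\<close>.\<close>

lemma Im_gap_kernel_integrable:
  "integrable (lborel \<Otimes>\<^sub>M lborel) (\<lambda>(s, v). indicat_real {0<..} s * (indicat_real {0<..} v * Im (gap_kernel b r s v)))"
proof -
  obtain a C where a: "a > 0" "C > 0" "\<And>s v. s > 0 \<Longrightarrow> v > 0 \<Longrightarrow>
      \<bar>Im (gap_kernel b r s v)\<bar> \<le> C * exp (- a * s) * (if v < 1 then 1 else v powr - b)"
    using gap_kernel_bounds by blast
  define A where "A s = (if 0 < s then exp (- a * s) else 0)" for s :: real
  define m where "m v = indicat_real {0..1} v + (if 1 < v then v powr - b else 0)" for v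
  have A: "integrable lborel A"
    using exp_minus_integrable[OF a(1)] by (simp add: A_def[abs_def] has_bochner_integral_iff)
  have m: "integrable lborel m"
    using tail_powr[OF b, of 1] unfolding m_def
    by (intro Bochner_Integration.integrable_add) (auto simp: has_bochner_integral_iff)
  have [measurable]: "A \<in> borel_measurable borel" "m \<in> borel_measurable borel"
    unfolding A_def m_def by measurable
  have "integrable (lborel \<Otimes>\<^sub>M lborel) (\<lambda>(s, v). C * A s * m v)"
  proof (rule lborel_pair.Fubini_integrable)
    have "(\<lambda>s. LINT v|lborel. norm (case (s, v) of (s, v) \<Rightarrow> C * A s * m v))
        = (\<lambda>s. \<bar>C\<bar> * \<bar>A s\<bar> * (LINT v|lborel. \<bar>m v\<bar>))"
      by (simp add: abs_mult)
    then show "integrable lborel (\<lambda>s. LINT v|lborel. norm (case (s, v) of (s, v) \<Rightarrow> C * A s * m v))"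
      using A by simp
  qed (use m in auto)
  then show ?thesis
  proof (rule Bochner_Integration.integrable_bound)
    show "AE x in lborel \<Otimes>\<^sub>M lborel. norm (case x of (s, v) \<Rightarrow>
        indicat_real {0<..} s * (indicat_real {0<..} v * Im (gap_kernel b r s v))) \<le> norm (case x of (s, v) \<Rightarrow> C * A s * m v)"
    proof (rule AE_I2, clarify)
      fix s v :: real
      have "\<bar>Im (gap_kernel b r s v)\<bar> \<le> C * A s * m v" if sv: "s > 0" "v > 0"
      proof -
        have "(if v < 1 then 1 else v powr - b) \<le> m v" using sv by (auto simp: m_def)
        then have "C * exp (- a * s) * (if v < 1 then 1 else v powr - b) \<le> C * exp (- a * s) * m v"
          using a by (intro mult_left_mono) auto
        then show ?thesis using a(3)[OF sv] sv by (simp add: A_def)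
      qed
      then show "norm (indicat_real {0<..} s * (indicat_real {0<..} v * Im (gap_kernel b r s v))) \<le> norm (C * A s * m v)"
        by (auto simp: indicator_def)
    qed
  qed measurable
qed

text \<open>Fubini, with the integral over \<open>s\<close> evaluated as
  \<open>- 1 / (r * full_exponent b v)\<close>. Along with the exchange it delivers integrability of
  the partial integrals; the second claim becomes the absolute convergence in the theorem.\<close>

lemma integral_Im_gap_kernel:
  shows "set_integrable lborel {0<..} (\<lambda>s. LINT v:{0<..}|lborel. Im (gap_kernel b r s v))"
    and "set_integrable lborel {0<..} (\<lambda>v. Im (cis (- (v powr - b)) / full_exponent b v))"
    and "(LINT s:{0<..}|lborel. LINT v:{0<..}|lborel. Im (gap_kernel b r s v))
       = - (LINT v:{0<..}|lborel. Im (cis (- (v powr - b)) / full_exponent b v)) / r"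
proof -
  define k where "k s v = indicat_real {0<..} s * (indicat_real {0<..} v * Im (gap_kernel b r s v))" for s v
  have k: "integrable (lborel \<Otimes>\<^sub>M lborel) (case_prod k)"
    using Im_gap_kernel_integrable by (simp add: k_def[abs_def])
  have 1: "(LINT v|lborel. k s v) = indicat_real {0<..} s * (LINT v:{0<..}|lborel. Im (gap_kernel b r s v))" for s
    by (simp add: k_def set_lebesgue_integral_def)
  have 2: "(LINT s|lborel. k s v) = - (1 / r) * (indicat_real {0<..} v * Im (cis (- (v powr - b)) / full_exponent b v))" for v
  proof (cases "v > 0")
    case True
    have neg: "Re (of_real r * full_exponent b v) < 0" using Re_full_exponent_neg[OF b True] r by (simp add: mult_pos_neg)
    note I = integral_exp_half_line[OF neg]
    have "(LINT s|lborel. k s v) = (LINT s|lborel. Im ((indicat_real {0<..} s *\<^sub>R exp (of_real s * (of_real r * full_exponent b v))) * cis (- (v powr - b))))"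
      using True by (intro Bochner_Integration.integral_cong) (auto simp: k_def gap_kernel_def mult_ac indicator_def)
    also have "\<dots> = Im (LINT s|lborel. (indicat_real {0<..} s *\<^sub>R exp (of_real s * (of_real r * full_exponent b v))) * cis (- (v powr - b)))"
      using I(2) unfolding set_integrable_def
      by (intro integral_Im integrable_mult_left)
    also have "(LINT s|lborel. (indicat_real {0<..} s *\<^sub>R exp (of_real s * (of_real r * full_exponent b v))) * cis (- (v powr - b)))
        = (LINT s:{0<..}|lborel. exp (of_real s * (of_real r * full_exponent b v))) * cis (- (v powr - b))"
      using I(2) unfolding set_lebesgue_integral_def set_integrable_def
      by (intro Bochner_Integration.integral_mult_left)
    also have "(LINT s:{0<..}|lborel. exp (of_real s * (of_real r * full_exponent b v))) * cis (- (v powr - b))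
        = of_real (- (1 / r)) * (cis (- (v powr - b)) / full_exponent b v)"
      unfolding I(1) using r full_exponent_nonzero[OF b True] by (simp add: field_simps)
    also have "Im (of_real (- (1 / r)) * (cis (- (v powr - b)) / full_exponent b v)) = - (1 / r) * Im (cis (- (v powr - b)) / full_exponent b v)"
      by (simp only: times_complex.sel Re_complex_of_real Im_complex_of_real mult_zero_left add_0_right)
    finally show ?thesis using True by simp
  qed (simp add: k_def)
  show "set_integrable lborel {0<..} (\<lambda>s. LINT v:{0<..}|lborel. Im (gap_kernel b r s v))"
    using lborel_pair.integrable_fst[OF k] by (simp add: 1 set_integrable_def)
  have "integrable lborel (\<lambda>v. LINT s|lborel. k s v)"
    using lborel_pair.integrable_snd[OF k] by simp
  then have "integrable lborel (\<lambda>v. - r * (- (1 / r) * (indicat_real {0<..} v * Im (cis (- (v powr - b)) / full_exponent b v))))"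
    unfolding 2 by (rule integrable_mult_right)
  then show "set_integrable lborel {0<..} (\<lambda>v. Im (cis (- (v powr - b)) / full_exponent b v))"
    using r by (simp add: set_integrable_def)
  have "(LINT s|lborel. LINT v|lborel. k s v) = (LINT v|lborel. LINT s|lborel. k s v)"
    using lborel_pair.Fubini_integral[OF k] by simp
  then show "(LINT s:{0<..}|lborel. LINT v:{0<..}|lborel. Im (gap_kernel b r s v))
       = - (LINT v:{0<..}|lborel. Im (cis (- (v powr - b)) / full_exponent b v)) / r"
    unfolding 1 2 by (simp add: set_lebesgue_integral_def)
qed

end

section \<open>Interchange with the expectation, and Dirichlet integrals\<close>

context prob_space
begin

text \<open>A bounded \<open>e\<close> against an integrable weight is integrable on the product,
  whatever the law of \<open>X\<close>. It is applied with \<open>cos\<close> on the unit interval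
  to detect an atom, and with \<open>sin\<close> and the truncated weight \<open>1 / s\<close> for
  the inversion.\<close>

lemma expectation_swap_bounded:
  fixes w g e :: "real \<Rightarrow> real"
  assumes w: "integrable lborel w" and [measurable]: "g \<in> borel_measurable borel"
    "e \<in> borel_measurable borel" "X \<in> borel_measurable M"
    and e: "\<And>x. \<bar>e x\<bar> \<le> 1"
  shows "expectation (\<lambda>\<omega>. LINT s|lborel. w s * e (g s * X \<omega>)) = (LINT s|lborel. w s * expectation (\<lambda>\<omega>. e (g s * X \<omega>)))"
proof -
  interpret pair_sigma_finite M lborel ..
  have [measurable]: "w \<in> borel_measurable borel"
    using borel_measurable_integrable[OF w] by simp
  have bound: "norm (w s * e x) \<le> norm (w s)" for s x
    using e[of x] mult_left_mono[of "\<bar>e x\<bar>" 1 "\<bar>w s\<bar>"] by (simp add: abs_mult)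
  have int: "integrable lborel (\<lambda>s. w s * e (g s * X \<omega>))" if "\<omega> \<in> space M" for \<omega>
    by (rule Bochner_Integration.integrable_bound[OF w]) (use bound in auto)
  have "integrable (M \<Otimes>\<^sub>M lborel) (\<lambda>(\<omega>, s). w s * e (g s * X \<omega>))"
  proof (rule Fubini_integrable)
    show "integrable M (\<lambda>\<omega>. LINT s|lborel. norm (case (\<omega>, s) of (\<omega>, s) \<Rightarrow> w s * e (g s * X \<omega>)))"
    proof (rule integrable_const_bound[where B="LINT s|lborel. norm (w s)"])
      show "AE \<omega> in M. norm (LINT s|lborel. norm (case (\<omega>, s) of (\<omega>, s) \<Rightarrow> w s * e (g s * X \<omega>))) \<le> (LINT s|lborel. norm (w s))"
      proof (rule AE_I2)
        fix \<omega> assume "\<omega> \<in> space M"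
        then have "(LINT s|lborel. norm (w s * e (g s * X \<omega>))) \<le> (LINT s|lborel. norm (w s))"
          using int w bound by (intro Bochner_Integration.integral_mono integrable_norm) auto
        then show "norm (LINT s|lborel. norm (case (\<omega>, s) of (\<omega>, s) \<Rightarrow> w s * e (g s * X \<omega>))) \<le> (LINT s|lborel. norm (w s))"
          by simp
      qed
    qed measurable
  qed (use int in auto)
  from Fubini_integral[OF this] show ?thesis by simp
qed

end

lemma integral_cos_unit_interval:
  "(LINT u|lborel. indicator {0..1} u * cos (u * c)) = sinc c"
proof (cases "c = 0")
  case False
  have "has_bochner_integral lborel (\<lambda>u. cos (u * c) * indicator {0..1} u) (sin (1 * c) / c - sin (0 * c) / c)"
    using False by (intro has_bochner_integral_FTC_Icc_real) (auto intro!: derivative_eq_intros)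
  then show ?thesis using False by (simp add: has_bochner_integral_iff mult.commute)
qed simp

text \<open>Under \<open>t = s powr b\<close> the measure \<open>ds / s\<close> becomes
  \<open>dt / (b * t)\<close>, so the primitive is a sine integral. This \<open>1 / b\<close> is the
  origin of the factor \<open>2 * c\<close> in front of the final integral.\<close>

lemma integral_sin_powr:
  fixes b x :: real
  assumes "b > 1" "0 < l" "l \<le> m"
  shows "(LINT s|lborel. indicator {l..m} s / s * sin (s powr b * x)) = (Si (m powr b * x) - Si (l powr b * x)) / b"
proof -
  have "has_bochner_integral lborel (\<lambda>s. (sin (s powr b * x) / s) * indicator {l..m} s)
    (Si (m powr b * x) / b - Si (l powr b * x) / b)"
  proof (rule has_bochner_integral_FTC_Icc_real)
    fix s assume s: "l \<le> s" "s \<le> m"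
    have "((\<lambda>s. s powr b * x) has_real_derivative b * s powr (b - 1) * x) (at s)"
      using s assms by (auto intro!: derivative_eq_intros)
    from DERIV_chain2[OF DERIV_Si this]
    have "((\<lambda>s. Si (s powr b * x)) has_real_derivative sinc (s powr b * x) * (b * s powr (b - 1) * x)) (at s)" .
    from DERIV_cdivide[OF this, of b]
    show "((\<lambda>s. Si (s powr b * x) / b) has_real_derivative sin (s powr b * x) / s) (at s)"
      by (rule DERIV_cong) (use s assms in \<open>auto simp: powr_diff\<close>)
    show "isCont (\<lambda>s. sin (s powr b * x) / s) s"
      using s assms by (intro continuous_intros) auto
  qed (use assms in auto)
  then show ?thesis
    by (simp add: has_bochner_integral_iff mult.commute diff_divide_distrib)
qed

lemma Si_uminus: "Si (- x) = - Si x"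
  using Si_neg[of x] Si_neg[of "- x"] by (cases "x \<ge> 0") auto

section \<open>Absence of an atom at \<open>0\<close>, and Gil-Pelaez inversion\<close>

context poisson_process
begin

context
  fixes b :: real
  assumes b: "b > 1"
begin

lemma cis_gap_integrable: "integrable M (\<lambda>\<omega>. cis (t * gap b \<omega>))"
  by (rule integrable_const_bound[where B=1]) auto

lemma characteristic_gap_kernel:
  "s > 0 \<Longrightarrow> expectation (\<lambda>\<omega>. cis (s powr b * gap b \<omega>)) = of_real (r * s) * (LINT v:{0<..}|lborel. gap_kernel b r s v)"
  unfolding gap_kernel_def[abs_def] by (rule characteristic_gap[OF b])

lemma expectation_cos_gap: "expectation (\<lambda>\<omega>. cos (t * gap b \<omega>)) = Re (expectation (\<lambda>\<omega>. cis (t * gap b \<omega>)))"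
  using integral_Re[OF cis_gap_integrable[of t]] by simp

lemma expectation_sin_gap: "expectation (\<lambda>\<omega>. sin (t * gap b \<omega>)) = Im (expectation (\<lambda>\<omega>. cis (t * gap b \<omega>)))"
  using integral_Im[OF cis_gap_integrable[of t]] by simp

lemma expectation_cos_gap_tendsto_0: "((\<lambda>t. expectation (\<lambda>\<omega>. cos (t * gap b \<omega>))) \<longlongrightarrow> 0) at_top"
proof -
  have "filterlim (\<lambda>t::real. t powr (1 / b)) at_top at_top"
    using b by real_asymp
  from tendsto_Re[OF filterlim_compose[OF integral_gap_kernel_tendsto_0[OF b intensity_pos] this]]
  have "((\<lambda>t. Re (of_real (r * t powr (1 / b)) * (LINT v:{0<..}|lborel. gap_kernel b r (t powr (1 / b)) v))) \<longlongrightarrow> 0) at_top"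
    by (simp only: zero_complex.sel)
  then show ?thesis
  proof (rule Lim_transform_eventually)
    show "eventually (\<lambda>t. Re (of_real (r * t powr (1 / b)) * (LINT v:{0<..}|lborel. gap_kernel b r (t powr (1 / b)) v))
       = expectation (\<lambda>\<omega>. cos (t * gap b \<omega>))) at_top"
      using eventually_gt_at_top[of 0]
    proof eventually_elim
      case (elim t)
      have "(t powr (1 / b)) powr b = t" using elim b by (simp add: powr_powr)
      then show ?case
        using characteristic_gap_kernel[of "t powr (1 / b)"] elim by (simp add: expectation_cos_gap)
    qed
  qed
qed

text \<open>Averaging \<open>cos (u * n * gap)\<close> over \<open>u\<close> in the unit interval
  gives \<open>sinc (n * gap)\<close>, which tends to the indicator of \<open>gap = 0\<close>. In
  expectation these are averages of the real part of the characteristic function at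
  \<open>u * n\<close>, and they tend to \<open>0\<close> because it decays.\<close>

lemma prob_gap_eq_0: "prob {\<omega> \<in> space M. gap b \<omega> = 0} = 0"
proof -
  have [measurable]: "sin \<in> borel_measurable (borel :: real measure)" "cos \<in> borel_measurable (borel :: real measure)"
    by (auto intro!: borel_measurable_continuous_onI continuous_intros)
  have E: "expectation (\<lambda>\<omega>. sinc (real n * gap b \<omega>))
      = (LINT u|lborel. indicator {0..1} u * expectation (\<lambda>\<omega>. cos ((u * real n) * gap b \<omega>)))" for n
  proof -
    have "expectation (\<lambda>\<omega>. LINT u|lborel. indicator {0..1} u * cos ((u * real n) * gap b \<omega>))
      = (LINT u|lborel. indicator {0..1} u * expectation (\<lambda>\<omega>. cos ((u * real n) * gap b \<omega>)))"
      by (rule expectation_swap_bounded[where e=cos]) auto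
    then show ?thesis by (simp only: mult.assoc integral_cos_unit_interval)
  qed
  have "(\<lambda>n. LINT u|lborel. indicator {0..1} u * expectation (\<lambda>\<omega>. cos ((u * real n) * gap b \<omega>)))
      \<longlonglongrightarrow> (LINT u::real|lborel. (0 :: real))"
  proof (rule integral_dominated_convergence[where w="indicator {0..1}"])
    show "AE u in lborel. (\<lambda>n. indicator {0..1} u * expectation (\<lambda>\<omega>. cos ((u * real n) * gap b \<omega>))) \<longlonglongrightarrow> 0"
      using AE_lborel_singleton[of 0]
    proof eventually_elim
      case (elim u)
      show ?case
      proof (cases "u \<in> {0..1}")
        case True
        with elim have "u > 0" by auto
        then have "filterlim (\<lambda>n. u * real n) at_top sequentially" by real_asymp
        from filterlim_compose[OF expectation_cos_gap_tendsto_0 this]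
        show ?thesis by (rule tendsto_mult_right_zero)
      qed simp
    qed
    show "AE u in lborel. norm (indicator {0..1} u * expectation (\<lambda>\<omega>. cos ((u * real n) * gap b \<omega>))) \<le> indicator {0..1} u" for n
    proof (rule AE_I2)
      fix u :: real
      have "\<bar>expectation (\<lambda>\<omega>. cos ((u * real n) * gap b \<omega>))\<bar> \<le> expectation (\<lambda>\<omega>. 1)"
        by (rule order_trans[OF integral_abs_bound Bochner_Integration.integral_mono])
           (auto intro!: integrable_const_bound[where B=1])
      then show "norm (indicator {0..1} u * expectation (\<lambda>\<omega>. cos ((u * real n) * gap b \<omega>))) \<le> indicator {0..1} u"
        by (simp add: indicator_def prob_space)
    qed
  qed auto
  then have lim1: "(\<lambda>n. expectation (\<lambda>\<omega>. sinc (real n * gap b \<omega>))) \<longlonglongrightarrow> 0"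
    by (simp only: E) simp
  have "(\<lambda>n. expectation (\<lambda>\<omega>. sinc (real n * gap b \<omega>))) \<longlonglongrightarrow> expectation (indicator {\<omega> \<in> space M. gap b \<omega> = 0})"
  proof (rule integral_dominated_convergence[where w="\<lambda>_. 1"])
    show "AE \<omega> in M. (\<lambda>n. sinc (real n * gap b \<omega>)) \<longlonglongrightarrow> indicator {\<omega> \<in> space M. gap b \<omega> = 0} \<omega>"
    proof (rule AE_I2)
      fix \<omega> assume w: "\<omega> \<in> space M"
      show "(\<lambda>n. sinc (real n * gap b \<omega>)) \<longlonglongrightarrow> indicator {\<omega> \<in> space M. gap b \<omega> = 0} \<omega>"
      proof (cases "gap b \<omega> = 0")
        case False
        have "(\<lambda>n. sinc (real n * gap b \<omega>)) \<longlonglongrightarrow> 0"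
        proof (rule Lim_null_comparison)
          show "eventually (\<lambda>n. norm (sinc (real n * gap b \<omega>)) \<le> 1 / (real n * \<bar>gap b \<omega>\<bar>)) sequentially"
            using eventually_gt_at_top[of 0]
            by eventually_elim (use False in \<open>auto simp: abs_mult divide_right_mono\<close>)
          have "(\<lambda>n. 1 / (real n * z)) \<longlonglongrightarrow> 0" if "z > 0" for z
            using that by real_asymp
          then show "(\<lambda>n. 1 / (real n * \<bar>gap b \<omega>\<bar>)) \<longlonglongrightarrow> 0" using False by simp
        qed
        then show ?thesis using False by simp
      qed (use w in simp)
    qed
    show "AE \<omega> in M. norm (sinc (real n * gap b \<omega>)) \<le> 1" for n
    proof (rule AE_I2)
      fix \<omega>
      show "norm (sinc (real n * gap b \<omega>)) \<le> 1"
        using abs_sin_x_le_abs_x[of "real n * gap b \<omega>"] by (auto simp: divide_simps)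
    qed
  qed auto
  from LIMSEQ_unique[OF this lim1] show ?thesis by simp
qed

text \<open>Gil-Pelaez inversion in the variable \<open>s\<close>. The Dirichlet integral converges
  only conditionally, so expectation and integral are exchanged on \<open>{1 / m..m}\<close>, where
  the weight \<open>1 / s\<close> is integrable. Both sides then converge dominatedly:
  \<open>Si\<close> is bounded, and \<open>J\<close> is integrable on the half-line.\<close>

lemma expectation_sgn_gap:
  "expectation (\<lambda>\<omega>. sgn (gap b \<omega>)) = - (2 * b / pi) * (LINT v:{0<..}|lborel. Im (cis (- (v powr - b)) / full_exponent b v))"
proof -
  have [measurable]: "sin \<in> borel_measurable (borel :: real measure)"
    by (auto intro!: borel_measurable_continuous_onI continuous_intros)
  define m where "m n = real (Suc n)" for n
  define w where "w n s = indicat_real {1 / m n..m n} s / s" for n s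
  define J where "J s = (LINT v:{0<..}|lborel. Im (gap_kernel b r s v))" for s
  have m: "m n \<ge> 1" for n by (simp add: m_def)
  have le: "1 / m n \<le> m n" "0 < 1 / m n" for n
    using m[of n] by (auto intro: order_trans[of _ 1])
  have w: "integrable lborel (w n)" for n
  proof -
    have "set_integrable lborel {1 / m n..m n} (\<lambda>s. 1 / s)"
      using le[of n] by (intro borel_integrable_atLeastAtMost' continuous_intros) auto
    then show ?thesis by (simp add: w_def[abs_def] set_integrable_def)
  qed
  have Jint: "set_integrable lborel {0<..} J"
    unfolding J_def by (rule integral_Im_gap_kernel(1)[OF b intensity_pos])
  have ES: "expectation (\<lambda>\<omega>. sin (s powr b * gap b \<omega>)) = r * s * J s" if "s > 0" for s
    unfolding expectation_sin_gap characteristic_gap_kernel[OF that] J_def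
    using integral_Im[OF gap_kernel_integrable[OF b intensity_pos that, unfolded set_integrable_def]]
    by (simp add: set_lebesgue_integral_def)
  have 1: "expectation (\<lambda>\<omega>. (Si (m n powr b * gap b \<omega>) - Si ((1 / m n) powr b * gap b \<omega>)) / b)
     = r * (LINT s|lborel. indicator {1 / m n..m n} s * J s)" for n
  proof -
    have "expectation (\<lambda>\<omega>. (Si (m n powr b * gap b \<omega>) - Si ((1 / m n) powr b * gap b \<omega>)) / b)
       = expectation (\<lambda>\<omega>. LINT s|lborel. w n s * sin (s powr b * gap b \<omega>))"
      unfolding w_def by (simp only: integral_sin_powr[OF b le(2,1)])
    also have "\<dots> = (LINT s|lborel. w n s * expectation (\<lambda>\<omega>. sin (s powr b * gap b \<omega>)))"
      by (rule expectation_swap_bounded[where e=sin, OF w]) auto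
    also have "\<dots> = (LINT s|lborel. r * (indicator {1 / m n..m n} s * J s))"
    proof (rule Bochner_Integration.integral_cong[OF refl])
      fix s
      have "s > 0" if "s \<in> {1 / m n..m n}" using that less_le_trans[OF le(2)[of n], of s] by simp
      then show "w n s * expectation (\<lambda>\<omega>. sin (s powr b * gap b \<omega>)) = r * (indicator {1 / m n..m n} s * J s)"
        by (auto simp: w_def ES indicator_def)
    qed
    finally show ?thesis by simp
  qed
  have "(\<lambda>n. LINT s|lborel. indicator {1 / m n..m n} s * J s) \<longlonglongrightarrow> (LINT s|lborel. indicator {0<..} s * J s)"
  proof (rule integral_dominated_convergence[where w="\<lambda>s. norm (indicat_real {0<..} s * J s)"])
    show meas: "(\<lambda>s. indicat_real {0<..} s * J s) \<in> borel_measurable lborel"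
      and "integrable lborel (\<lambda>s. norm (indicat_real {0<..} s * J s))"
      using Jint borel_measurable_integrable by (auto simp: set_integrable_def)
    have eq: "indicat_real {1 / m n..m n} s * J s = indicat_real {1 / m n..m n} s * (indicat_real {0<..} s * J s)" for n s
      using less_le_trans[OF le(2)[of n], of s] by (auto simp: indicator_def)
    show "(\<lambda>s. indicat_real {1 / m n..m n} s * J s) \<in> borel_measurable lborel" for n
      by (subst eq) (use meas in measurable)
    show "AE s in lborel. norm (indicat_real {1 / m n..m n} s * J s) \<le> norm (indicat_real {0<..} s * J s)" for n
      using less_le_trans[OF le(2)[of n]] by (auto simp: indicator_def)
    show "AE s in lborel. (\<lambda>n. indicat_real {1 / m n..m n} s * J s) \<longlonglongrightarrow> indicat_real {0<..} s * J s"
    proof (rule AE_I2)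
      fix s :: real
      have "eventually (\<lambda>n. indicat_real {1 / m n..m n} s * J s = indicat_real {0<..} s * J s) sequentially"
      proof (cases "s > 0")
        case True
        show ?thesis
          using eventually_ge_at_top[of "nat \<lceil>max s (1 / s)\<rceil>"]
        proof eventually_elim
          case (elim n)
          then have "s \<le> m n" "1 / s \<le> m n" unfolding m_def by linarith+
          then have "s \<in> {1 / m n..m n}" using True m[of n] by (auto simp: field_simps)
          then show ?case using True by simp
        qed
      next
        case False
        then have "s \<notin> {1 / m n..m n}" for n using less_le_trans[OF le(2)[of n], of s] by auto
        then show ?thesis using False by simp
      qed
      then show "(\<lambda>n. indicat_real {1 / m n..m n} s * J s) \<longlonglongrightarrow> indicat_real {0<..} s * J s"
        by (rule tendsto_eventually)
    qed
  qed
  then have lim1: "(\<lambda>n. r * (LINT s|lborel. indicator {1 / m n..m n} s * J s)) \<longlonglongrightarrow> r * (LINT s:{0<..}|lborel. J s)"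
    by (intro tendsto_mult_left) (simp add: set_lebesgue_integral_def)
  have lim2: "(\<lambda>n. expectation (\<lambda>\<omega>. (Si (m n powr b * gap b \<omega>) - Si ((1 / m n) powr b * gap b \<omega>)) / b))
      \<longlonglongrightarrow> expectation (\<lambda>\<omega>. (pi / 2 * sgn (gap b \<omega>)) / b)"
  proof -
    obtain B where B: "\<And>x. \<bar>Si x\<bar> \<le> B" using bounded_Si by blast
    show ?thesis
    proof (rule integral_dominated_convergence[where w="\<lambda>_. (B + B) / b"])
      show "AE \<omega> in M. norm ((Si (m n powr b * gap b \<omega>) - Si ((1 / m n) powr b * gap b \<omega>)) / b) \<le> (B + B) / b" for n
      proof (rule AE_I2)
        fix \<omega>
        have "\<bar>Si (m n powr b * gap b \<omega>) - Si ((1 / m n) powr b * gap b \<omega>)\<bar> \<le> B + B"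
          by (rule order_trans[OF abs_triangle_ineq4 add_mono[OF B B]])
        then show "norm ((Si (m n powr b * gap b \<omega>) - Si ((1 / m n) powr b * gap b \<omega>)) / b) \<le> (B + B) / b"
          using b by (simp add: abs_divide divide_right_mono)
      qed
      have S0: "(\<lambda>n. Si ((1 / m n) powr b * z)) \<longlonglongrightarrow> 0" for z
      proof -
        have "(\<lambda>n. (1 / m n) powr b) \<longlonglongrightarrow> 0" unfolding m_def using b by real_asymp
        then have "(\<lambda>n. (1 / m n) powr b * z) \<longlonglongrightarrow> 0" by (rule tendsto_mult_left_zero)
        from isCont_tendsto_compose[OF isCont_Si this] show ?thesis using Si_neg[of 0] by simp
      qed
      have S1: "(\<lambda>n. Si (m n powr b * z)) \<longlonglongrightarrow> pi / 2" if "z > 0" for z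
      proof -
        have "filterlim (\<lambda>n. m n powr b * z) at_top sequentially"
          unfolding m_def using b that by real_asymp
        from filterlim_compose[OF Si_at_top this] show ?thesis .
      qed
      have S: "(\<lambda>n. Si (m n powr b * z)) \<longlonglongrightarrow> pi / 2 * sgn z" for z
      proof (cases z "0 :: real" rule: linorder_cases)
        case less
        then show ?thesis using tendsto_minus[OF S1[of "- z"]] by (simp add: Si_uminus)
      qed (use S1 Si_neg[of 0] in auto)
      show "AE \<omega> in M. (\<lambda>n. (Si (m n powr b * gap b \<omega>) - Si ((1 / m n) powr b * gap b \<omega>)) / b)
         \<longlonglongrightarrow> (pi / 2 * sgn (gap b \<omega>)) / b"
      proof (rule AE_I2)
        fix \<omega>
        have "(\<lambda>n. (Si (m n powr b * gap b \<omega>) - Si ((1 / m n) powr b * gap b \<omega>)) / b)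
         \<longlonglongrightarrow> (pi / 2 * sgn (gap b \<omega>) - 0) / b"
          using b by (intro tendsto_intros S S0) auto
        then show "(\<lambda>n. (Si (m n powr b * gap b \<omega>) - Si ((1 / m n) powr b * gap b \<omega>)) / b)
         \<longlonglongrightarrow> (pi / 2 * sgn (gap b \<omega>)) / b" by simp
      qed
    qed auto
  qed
  have "expectation (\<lambda>\<omega>. (pi / 2 * sgn (gap b \<omega>)) / b) = r * (LINT s:{0<..}|lborel. J s)"
    by (rule LIMSEQ_unique[OF lim2]) (use lim1 in \<open>simp only: 1\<close>)
  also have "\<dots> = - (LINT v:{0<..}|lborel. Im (cis (- (v powr - b)) / full_exponent b v))"
    unfolding J_def integral_Im_gap_kernel(3)[OF b intensity_pos] using intensity_pos by simp
  also have "expectation (\<lambda>\<omega>. (pi / 2 * sgn (gap b \<omega>)) / b) = pi / (2 * b) * expectation (\<lambda>\<omega>. sgn (gap b \<omega>))"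
    by simp
  finally show ?thesis using b by (simp add: field_simps)
qed

lemma prob_gap_le_0:
  "prob {\<omega> \<in> space M. gap b \<omega> \<le> 0}
    = 1 / 2 + b / pi * (LINT v:{0<..}|lborel. Im (cis (- (v powr - b)) / full_exponent b v))"
proof -
  have "expectation (\<lambda>\<omega>. sgn (gap b \<omega>)) = expectation (\<lambda>\<omega>. 1 - 2 * indicator {\<omega> \<in> space M. gap b \<omega> \<le> 0} \<omega>
      + indicator {\<omega> \<in> space M. gap b \<omega> = 0} \<omega>)"
    by (intro Bochner_Integration.integral_cong) (auto simp: indicator_def sgn_if)
  also have "\<dots> = 1 - 2 * prob {\<omega> \<in> space M. gap b \<omega> \<le> 0} + prob {\<omega> \<in> space M. gap b \<omega> = 0}"
    by (subst Bochner_Integration.integral_add Bochner_Integration.integral_diff;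
        auto simp: prob_space integrable_indicator_iff emeasure_eq_measure)+
  finally show ?thesis using prob_gap_eq_0 expectation_sgn_gap by simp
qed

end

end

text \<open>The phase \<open>pi / (2 * b)\<close> in the exponential cancels the one in
  \<open>lower_gamma\<close>, and the remaining factor \<open>y powr (- 1 - 1 / b) / b\<close> is
  exactly the Jacobian of \<open>v = y powr (- 1 / b)\<close>.\<close>

lemma integral_full_exponent_substitution:
  fixes b :: real
  assumes b: "b > 1"
  defines "F \<equiv> (\<lambda>y::real. Im (exp (complex_of_real (pi / (2 * b) - y) * \<i>)
               / lower_gamma (complex_of_real (- 1 / b)) (- \<i> * complex_of_real y))
           * y powr (- 1 - 1 / b))"
  shows "set_integrable lborel {0<..} F"
    and "(LINT y:{0<..}|lborel. F y) = (LINT v:{0<..}|lborel. Im (cis (- (v powr - b)) / full_exponent b v))"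
proof -
  define f where "f v = Im (cis (- (v powr - b)) / full_exponent b v)" for v
  define g where "g y = y powr (- 1 / b)" for y :: real
  define h where "h y = (- 1 / b) * y powr (- 1 / b - 1)" for y :: real
  \<comment> \<open>The integrand does not contain the rate, so integrability may be read off at
    rate \<open>1\<close>.\<close>
  have f: "set_integrable lborel {0<..} f"
    unfolding f_def by (rule integral_Im_gap_kernel(2)[OF b zero_less_one])
  have g_pow: "g y powr - b = y" "y powr - b > 0" if "y > 0" for y
    using that b by (simp_all add: g_def powr_powr)
  have F_eq: "F y = \<bar>h y\<bar> * f (g y)" if y: "y > 0" for y
  proof -
    have gy: "g y > 0" using y by (simp add: g_def)
    have "lower_gamma (complex_of_real (- 1 / b)) (- \<i> * complex_of_real y)
        = of_real b * cis (pi / (2 * b)) * full_exponent b (g y)"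
      using lower_gamma_eq_full_exponent[OF b gy] by (simp add: g_pow y)
    moreover have "exp (complex_of_real (pi / (2 * b) - y) * \<i>) = cis (pi / (2 * b)) * cis (- y)"
      unfolding cis_mult by (simp add: cis_conv_exp mult.commute)
    ultimately have "exp (complex_of_real (pi / (2 * b) - y) * \<i>)
               / lower_gamma (complex_of_real (- 1 / b)) (- \<i> * complex_of_real y)
        = of_real (1 / b) * (cis (- y) / full_exponent b (g y))"
      using b by (simp add: field_simps)
    moreover have "Im (of_real (1 / b) * (cis (- y) / full_exponent b (g y))) = 1 / b * Im (cis (- y) / full_exponent b (g y))"
      by (simp only: times_complex.sel Re_complex_of_real Im_complex_of_real mult_zero_left add_0_right)
    ultimately have "F y = 1 / b * Im (cis (- y) / full_exponent b (g y)) * y powr (- 1 - 1 / b)"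
      by (simp add: F_def)
    moreover have "\<bar>h y\<bar> = 1 / b * y powr (- 1 - 1 / b)"
    proof -
      have e: "- 1 / b - 1 = - 1 - 1 / b" by simp
      have "h y = - (1 / b * y powr (- 1 - 1 / b))" unfolding h_def e by simp
      then show ?thesis using b by (simp only: abs_minus_cancel) simp
    qed
    ultimately show ?thesis by (simp add: f_def g_pow y)
  qed
  have img: "g ` {0<..} = {0<..}"
  proof
    show "{0<..} \<subseteq> g ` {0<..}"
    proof
      fix v :: real assume "v \<in> {0<..}"
      then have "v = g (v powr - b)" "v powr - b \<in> {0<..}" using b by (simp_all add: g_def powr_powr)
      then show "v \<in> g ` {0<..}" by blast
    qed
  qed (auto simp: g_def)
  have inj: "inj_on g {0<..}"
    by (rule inj_on_inverseI[of _ "\<lambda>v. v powr - b"]) (simp add: g_pow)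
  have der: "(g has_field_derivative h y) (at y within {0<..})" if "y \<in> {0<..}" for y
    unfolding g_def h_def using that by (auto intro!: derivative_eq_intros)
  \<comment> \<open>The change of variables lives on Lebesgue measure, the completion of
    \<open>lborel\<close>; the way back to \<open>lborel\<close> uses the Borel measurability in
    \<open>hf_meas\<close>.\<close>
  have "f absolutely_integrable_on {0<..}"
    using f unfolding set_integrable_def by (subst integrable_completion) auto
  then have "f absolutely_integrable_on g ` {0<..} \<and> integral (g ` {0<..}) f = integral {0<..} f"
    by (simp add: img)
  then have cv: "(\<lambda>y. \<bar>h y\<bar> * f (g y)) absolutely_integrable_on {0<..}"
      "integral {0<..} (\<lambda>y. \<bar>h y\<bar> * f (g y)) = integral {0<..} f"
    using has_absolute_integral_change_of_variables_1'[OF _ der inj, of f "integral {0<..} f"] by auto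
  have hf_meas: "(\<lambda>y. indicat_real {0<..} y *\<^sub>R (\<bar>h y\<bar> * f (g y))) \<in> borel_measurable lborel"
    unfolding h_def f_def g_def by measurable
  have hf: "set_integrable lborel {0<..} (\<lambda>y. \<bar>h y\<bar> * f (g y))"
    using cv(1) hf_meas unfolding set_integrable_def by (subst (asm) integrable_completion) auto
  have eq: "indicat_real {0<..} y *\<^sub>R F y = indicat_real {0<..} y *\<^sub>R (\<bar>h y\<bar> * f (g y))" for y
    using F_eq by (auto simp: indicator_def)
  show "set_integrable lborel {0<..} F"
    using hf by (simp only: set_integrable_def eq)
  have "(LINT y:{0<..}|lborel. F y) = (LINT y:{0<..}|lborel. \<bar>h y\<bar> * f (g y))"
    by (simp only: set_lebesgue_integral_def eq)
  also have "\<dots> = integral {0<..} (\<lambda>y. \<bar>h y\<bar> * f (g y))"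
    by (rule set_borel_integral_eq_integral(2)[OF hf])
  also have "\<dots> = (LINT v:{0<..}|lborel. f v)"
    unfolding cv(2) by (rule set_borel_integral_eq_integral(2)[OF f, symmetric])
  finally show "(LINT y:{0<..}|lborel. F y) = (LINT v:{0<..}|lborel. Im (cis (- (v powr - b)) / full_exponent b v))"
    by (simp add: f_def)
qed

section \<open>The balancing exponent\<close>

lemma suminf_ennreal_eq_1_iff:
  assumes "\<And>j. f j \<ge> 0"
  shows "(\<Sum>j. ennreal (f j)) = 1 \<longleftrightarrow> f sums 1"
proof
  assume "(\<Sum>j. ennreal (f j)) = 1"
  then have "(\<lambda>j. ennreal (f j)) sums ennreal 1"
    using summable_sums[OF summableI, of "\<lambda>j. ennreal (f j)"] by simp
  then show "f sums 1" using assms by (subst (asm) sums_ennreal) auto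
next
  assume "f sums 1"
  then show "(\<Sum>j. ennreal (f j)) = 1" using suminf_ennreal_eq[OF assms] by simp
qed

lemma suminf_ennreal_le_1_iff:
  assumes "\<And>j. f j \<ge> 0"
  shows "(\<Sum>j. ennreal (f j)) \<le> 1 \<longleftrightarrow> summable f \<and> suminf f \<le> 1"
proof
  assume le: "(\<Sum>j. ennreal (f j)) \<le> 1"
  then have s: "summable f" using assms by (intro summable_suminf_not_top) (auto simp: top_unique)
  then show "summable f \<and> suminf f \<le> 1"
    using le suminf_ennreal2[OF assms s] by simp
next
  assume "summable f \<and> suminf f \<le> 1"
  then show "(\<Sum>j. ennreal (f j)) \<le> 1" using suminf_ennreal2[OF assms] by simp
qed

lemma powr_sum_strict_antimono:
  fixes \<rho> :: "nat \<Rightarrow> real"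
  assumes \<rho>: "\<And>j. \<rho> j > 1" and "x < y" and x: "summable (\<lambda>j. \<rho> j powr - x)"
  shows "summable (\<lambda>j. \<rho> j powr - y)" and "(\<Sum>j. \<rho> j powr - y) < (\<Sum>j. \<rho> j powr - x)"
proof -
  have less: "\<rho> j powr - y < \<rho> j powr - x" for j
    using \<rho>[of j] \<open>x < y\<close> by (intro powr_less_mono) auto
  show y: "summable (\<lambda>j. \<rho> j powr - y)"
    by (rule summable_comparison_test[OF _ x]) (use less less_imp_le in auto)
  have "0 < (\<Sum>j. \<rho> j powr - x - \<rho> j powr - y)"
    using less by (intro suminf_pos summable_diff x y) auto
  then show "(\<Sum>j. \<rho> j powr - y) < (\<Sum>j. \<rho> j powr - x)"
    using suminf_diff[OF x y] by simp
qed

text \<open>Intermediate values: the sum exceeds \<open>1\<close> at some exponent near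
  \<open>1\<close>, drops below \<open>1\<close> at a large one, and is continuous in between by the
  Weierstrass test with the terms at the smaller exponent as majorant.\<close>

lemma powr_sum_attains_1:
  fixes \<rho> :: "nat \<Rightarrow> real"
  assumes \<rho>: "\<And>j. \<rho> j > 1" "\<And>j. \<rho> 0 \<le> \<rho> j"
    and summ: "\<And>x. x > 1 \<Longrightarrow> summable (\<lambda>j. \<rho> j powr - x)"
    and nsumm: "\<not> summable (\<lambda>j. \<rho> j powr - 1)"
  shows "\<exists>x>1. (\<lambda>j. \<rho> j powr - x) sums 1"
proof -
  define s where "s x = (\<Sum>j. \<rho> j powr - x)" for x
  have ne: "\<rho> j \<noteq> 0" for j using \<rho>(1)[of j] by simp
  \<comment> \<open>The full series diverges at exponent \<open>1\<close>, so its continuity there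
    is not at hand. A partial sum above \<open>1\<close> is continuous and bounds the series from
    below.\<close>
  obtain n where n: "(\<Sum>j<n. \<rho> j powr - 1) > 1"
  proof (rule ccontr)
    assume "\<not> thesis"
    then have "(\<Sum>j<n. \<rho> j powr - 1) \<le> 1" for n using that[of n] by force
    then have "(\<Sum>j\<le>n. \<rho> j powr - 1) \<le> 1" for n
      by (simp only: lessThan_Suc_atMost[symmetric])
    then have "summable (\<lambda>j. \<rho> j powr - 1)"
      by (intro bounded_imp_summable[where B=1]) auto
    then show False using nsumm by simp
  qed
  have "isCont (\<lambda>x. \<Sum>j<n. \<rho> j powr - x) 1"
    by (intro continuous_intros) (auto simp: ne)
  then have "((\<lambda>x. \<Sum>j<n. \<rho> j powr - x) \<longlongrightarrow> (\<Sum>j<n. \<rho> j powr - 1)) (at_right 1)"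
    by (simp add: isCont_def filterlim_at_split)
  then have "eventually (\<lambda>x. (\<Sum>j<n. \<rho> j powr - x) > 1 \<and> x > 1) (at_right 1)"
    using n by (auto simp: order_tendsto_iff eventually_conj_iff eventually_at_right_less)
  then obtain x where x: "x > 1" "(\<Sum>j<n. \<rho> j powr - x) > 1"
    using eventually_happens[of _ "at_right (1::real)"] by (auto simp: trivial_limit_at_right_real)
  have sx: "s x > 1"
    unfolding s_def by (rule less_le_trans[OF x(2) sum_le_suminf[OF summ[OF x(1)]]]) auto
  \<comment> \<open>The smallest base controls all terms at once: raising the exponent from
    \<open>x\<close> to \<open>y\<close> shrinks each by at least the factor
    \<open>\<rho> 0 powr (x - y)\<close>, which tends to \<open>0\<close> as
    \<open>\<rho> 0 > 1\<close>.\<close>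
  have "((\<lambda>y. \<rho> 0 powr (x - y) * s x) \<longlongrightarrow> 0) at_top"
    using \<rho>(1)[of 0] by real_asymp
  then have "eventually (\<lambda>y. \<rho> 0 powr (x - y) * s x < 1 \<and> y \<ge> x) at_top"
    by (auto simp: order_tendsto_iff eventually_conj_iff eventually_ge_at_top)
  then obtain y where y: "y \<ge> x" "\<rho> 0 powr (x - y) * s x < 1"
    using eventually_happens[of _ "at_top :: real filter"] by auto
  have sy: "s y < 1"
  proof -
    have "\<rho> j powr - y \<le> \<rho> 0 powr (x - y) * \<rho> j powr - x" for j
    proof -
      have "\<rho> j powr - y = \<rho> j powr (x - y) * \<rho> j powr - x" by (simp add: powr_add[symmetric])
      also have "\<dots> \<le> \<rho> 0 powr (x - y) * \<rho> j powr - x"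
        using \<rho>(1)[of 0] \<rho>(2)[of j] y(1) by (intro mult_right_mono powr_mono2') auto
      finally show ?thesis .
    qed
    then have "s y \<le> (\<Sum>j. \<rho> 0 powr (x - y) * \<rho> j powr - x)"
      unfolding s_def using x y by (intro suminf_le summable_mult summ) auto
    also have "\<dots> = \<rho> 0 powr (x - y) * s x"
      unfolding s_def by (rule suminf_mult[OF summ[OF x(1)]])
    finally show ?thesis using y(2) by simp
  qed
  have "continuous_on {x..y} s"
  proof (rule uniform_limit_theorem)
    show "uniform_limit {x..y} (\<lambda>n z. \<Sum>j<n. \<rho> j powr - z) s sequentially"
      unfolding s_def
    proof (rule Weierstrass_m_test[OF _ summ[OF x(1)]])
      fix j z assume "z \<in> {x..y}"
      then show "norm (\<rho> j powr - z) \<le> \<rho> j powr - x"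
        using \<rho>(1)[of j] by simp
    qed
    show "\<forall>\<^sub>F n in sequentially. continuous_on {x..y} (\<lambda>z. \<Sum>j<n. \<rho> j powr - z)"
      by (intro always_eventually allI continuous_intros) (auto simp: ne)
  qed simp
  then obtain z where z: "x \<le> z" "s z = 1"
    using IVT2'[of s y 1 x] sx sy y(1) by auto
  have "(\<lambda>j. \<rho> j powr - z) sums s z"
    unfolding s_def using x z by (intro summable_sums summ) auto
  then show ?thesis using x z by (intro exI[of _ z]) auto
qed

text \<open>For non-negative terms unordered \<open>has_sum\<close> and ordered \<open>sums\<close>
  agree, and dividing by the term of the first point normalises the value to
  \<open>1\<close>.\<close>

lemma is_balance_exponent_iff:
  assumes t: "\<And>j. j \<ge> 1 \<Longrightarrow> t j > 0"
  shows "is_balance_exponent t \<sigma> \<longleftrightarrow>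
    \<sigma> > 1 / 2 \<and> (\<lambda>j. (t (Suc (Suc j)) / t 1) powr - (2 * \<sigma>)) sums 1"
proof -
  have img: "{2..} = (\<lambda>j::nat. Suc (Suc j)) ` UNIV"
  proof (intro set_eqI iffI)
    fix n :: nat assume "n \<in> {2..}"
    then have "n = Suc (Suc (n - 2))" by auto
    then show "n \<in> (\<lambda>j. Suc (Suc j)) ` UNIV" by blast
  qed auto
  have "((\<lambda>j. t j powr (- 2 * \<sigma>)) has_sum t 1 powr (- 2 * \<sigma>)) {2..}
      \<longleftrightarrow> ((\<lambda>j. t (Suc (Suc j)) powr (- 2 * \<sigma>)) has_sum t 1 powr (- 2 * \<sigma>)) UNIV"
    unfolding img by (subst has_sum_reindex) (auto simp: inj_on_def o_def)
  also have "\<dots> \<longleftrightarrow> (\<lambda>j. t (Suc (Suc j)) powr (- 2 * \<sigma>)) sums t 1 powr (- 2 * \<sigma>)"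
    using has_sum_imp_sums sums_nonneg_imp_has_sum by (metis powr_ge_zero)
  also have "\<dots> \<longleftrightarrow> (\<lambda>j. t (Suc (Suc j)) powr (- 2 * \<sigma>) / t 1 powr (- 2 * \<sigma>)) sums 1"
  proof
    assume "(\<lambda>j. t (Suc (Suc j)) powr (- 2 * \<sigma>)) sums t 1 powr (- 2 * \<sigma>)"
    from sums_divide[OF this, of "t 1 powr (- 2 * \<sigma>)"]
    show "(\<lambda>j. t (Suc (Suc j)) powr (- 2 * \<sigma>) / t 1 powr (- 2 * \<sigma>)) sums 1"
      using t[of 1] by simp
  next
    assume "(\<lambda>j. t (Suc (Suc j)) powr (- 2 * \<sigma>) / t 1 powr (- 2 * \<sigma>)) sums 1"
    from sums_mult2[OF this, of "t 1 powr (- 2 * \<sigma>)"]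
    show "(\<lambda>j. t (Suc (Suc j)) powr (- 2 * \<sigma>)) sums t 1 powr (- 2 * \<sigma>)"
      using t[of 1] by simp
  qed
  also have "(\<lambda>j. t (Suc (Suc j)) powr (- 2 * \<sigma>) / t 1 powr (- 2 * \<sigma>))
      = (\<lambda>j. (t (Suc (Suc j)) / t 1) powr - (2 * \<sigma>))"
    using t by (auto simp: powr_divide less_imp_le)
  finally show ?thesis by (simp add: is_balance_exponent_def)
qed

section \<open>Uniqueness, almost sure existence and measurability of the exponent\<close>

context poisson_process
begin

text \<open>Points below \<open>1\<close> have powers that grow with the exponent; after division by
  the first point all bases exceed \<open>1\<close>, and the sum is strictly decreasing.\<close>

definition point_ratio :: "nat \<Rightarrow> 'a \<Rightarrow> real" where
  "point_ratio j \<omega> = T (Suc (Suc j)) \<omega> / T 1 \<omega>"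

text \<open>The values lie in \<open>ennreal\<close> so that a divergent sum is infinite and fails
  \<open><= 1\<close>, and so that measurability needs no distinction by summability.\<close>

definition ratio_sum :: "real \<Rightarrow> 'a \<Rightarrow> ennreal" where
  "ratio_sum \<sigma> \<omega> = (\<Sum>j. ennreal (point_ratio j \<omega> powr - (2 * \<sigma>)))"

lemma point_ratio_measurable [measurable]: "point_ratio j \<in> borel_measurable M"
  unfolding point_ratio_def by measurable

lemma ratio_sum_measurable [measurable (raw)]:
  assumes [measurable]: "X \<in> borel_measurable M"
  shows "(\<lambda>\<omega>. ratio_sum (X \<omega>) \<omega>) \<in> borel_measurable M"
  unfolding ratio_sum_def by measurable

lemma point_ratio_gt_1: "\<omega> \<in> space M \<Longrightarrow> point_ratio j \<omega> > 1"
  using points_less[of \<omega> 1 "Suc (Suc j)"] points_pos[of \<omega>] by (simp add: point_ratio_def)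

lemma point_ratio_ge: "\<omega> \<in> space M \<Longrightarrow> point_ratio 0 \<omega> \<le> point_ratio j \<omega>"
  using points_mono[of \<omega> "Suc (Suc 0)" "Suc (Suc j)"] points_pos[of \<omega>]
  by (simp add: point_ratio_def divide_right_mono)

lemma is_balance_exponent_ratio_sum_iff:
  "\<omega> \<in> space M \<Longrightarrow> is_balance_exponent (\<lambda>j. T j \<omega>) \<sigma> \<longleftrightarrow> \<sigma> > 1 / 2 \<and> ratio_sum \<sigma> \<omega> = 1"
  using point_pos by (subst is_balance_exponent_iff) (auto simp: ratio_sum_def suminf_ennreal_eq_1_iff point_ratio_def)

text \<open>Strict monotonicity in the exponent. The equivalence yields uniqueness of the exponent,
  its description as an infimum over rationals, and the translation of the event in the
  theorem.\<close>

lemma ratio_sum_le_1_iff: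
  assumes "\<omega> \<in> space M" and 1: "ratio_sum \<sigma> \<omega> = 1"
  shows "ratio_sum \<tau> \<omega> \<le> 1 \<longleftrightarrow> \<sigma> \<le> \<tau>"
proof -
  note point_ratio = point_ratio_gt_1[OF assms(1)]
  have \<sigma>: "(\<lambda>j. point_ratio j \<omega> powr - (2 * \<sigma>)) sums 1"
    using 1 by (simp add: ratio_sum_def suminf_ennreal_eq_1_iff)
  show ?thesis
  proof (cases \<sigma> \<tau> rule: linorder_cases)
    case less
    then show ?thesis
      using powr_sum_strict_antimono[of "\<lambda>j. point_ratio j \<omega>", OF point_ratio, of "2 * \<sigma>" "2 * \<tau>"] sums_summable[OF \<sigma>] sums_unique[OF \<sigma>]
      by (simp add: ratio_sum_def suminf_ennreal_le_1_iff)
  next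
    case equal
    then show ?thesis using 1 by simp
  next
    case greater
    then have "\<not> ratio_sum \<tau> \<omega> \<le> 1"
      using powr_sum_strict_antimono[of "\<lambda>j. point_ratio j \<omega>", OF point_ratio, of "2 * \<tau>" "2 * \<sigma>"] sums_unique[OF \<sigma>]
      by (auto simp: ratio_sum_def suminf_ennreal_le_1_iff)
    then show ?thesis using greater by simp
  qed
qed

lemma balance_exponent_eq:
  assumes w: "\<omega> \<in> space M" and "is_balance_exponent (\<lambda>j. T j \<omega>) \<sigma>"
  shows "balance_exponent (\<lambda>j. T j \<omega>) = \<sigma>"
  unfolding balance_exponent_def
proof (rule the_equality)
  fix \<tau> assume "is_balance_exponent (\<lambda>j. T j \<omega>) \<tau>"
  then show "\<tau> = \<sigma>"
    using assms(2) ratio_sum_le_1_iff[OF w, of \<sigma> \<tau>] ratio_sum_le_1_iff[OF w, of \<tau> \<sigma>]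
    by (simp add: is_balance_exponent_ratio_sum_iff[OF w])
qed fact

lemma AE_ex_balance_exponent: "AE \<omega> in M. \<exists>\<sigma>. is_balance_exponent (\<lambda>j. T j \<omega>) \<sigma>"
proof -
  \<comment> \<open>Countably many exponents tending to \<open>1\<close> share one null set; every
    other exponent above \<open>1\<close> is then covered by monotonicity.\<close>
  have "AE \<omega> in M. \<forall>n. summable (\<lambda>j. T (Suc j) \<omega> powr - (1 + 1 / real (Suc n)))"
    unfolding AE_all_countable by (intro allI AE_summable_powr) simp
  then show ?thesis
    using AE_not_summable_inverse AE_space
  proof eventually_elim
    fix \<omega> assume s: "\<forall>n. summable (\<lambda>j. T (Suc j) \<omega> powr - (1 + 1 / real (Suc n)))"
      and ns: "\<not> summable (\<lambda>j. T (Suc j) \<omega> powr - 1)" and w: "\<omega> \<in> space M"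
    have pos: "T (Suc j) \<omega> > 0" for j using point_pos[OF w] by simp
    have eq: "point_ratio j \<omega> powr - x = T (Suc (Suc j)) \<omega> powr - x / T 1 \<omega> powr - x" for j x
      using pos[of 0] pos[of "Suc j"] by (simp add: point_ratio_def powr_divide)
    have "summable (\<lambda>j. point_ratio j \<omega> powr - x)" if x: "x > 1" for x
    proof -
      obtain n where "inverse (real (Suc n)) < x - 1" using reals_Archimedean[of "x - 1"] x by auto
      then have n: "1 + 1 / real (Suc n) < x" by (simp add: divide_inverse)
      have "summable (\<lambda>j. point_ratio j \<omega> powr - (1 + 1 / real (Suc n)))"
        unfolding eq using s[rule_format, of n] by (intro summable_divide) (subst summable_Suc_iff)
      from powr_sum_strict_antimono(1)[of "\<lambda>j. point_ratio j \<omega>", OF point_ratio_gt_1[OF w] n this] show ?thesis .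
    qed
    moreover have "\<not> summable (\<lambda>j. point_ratio j \<omega> powr - 1)"
    proof
      assume "summable (\<lambda>j. point_ratio j \<omega> powr - 1)"
      then have "summable (\<lambda>j. T (Suc (Suc j)) \<omega> powr - 1)"
        unfolding eq using pos[of 0] by (subst (asm) summable_divide_iff) auto
      then show False using ns summable_Suc_iff[of "\<lambda>j. T (Suc j) \<omega> powr - 1"] by blast
    qed
    ultimately obtain x where "x > 1" "(\<lambda>j. point_ratio j \<omega> powr - x) sums 1"
      using powr_sum_attains_1[of "\<lambda>j. point_ratio j \<omega>", OF point_ratio_gt_1[OF w] point_ratio_ge[OF w]] by blast
    then have "is_balance_exponent (\<lambda>j. T j \<omega>) (x / 2)"
      unfolding is_balance_exponent_ratio_sum_iff[OF w] by (simp add: ratio_sum_def suminf_ennreal_eq_1_iff)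
    then show "\<exists>\<sigma>. is_balance_exponent (\<lambda>j. T j \<omega>) \<sigma>" ..
  qed
qed

text \<open>The exponent, where it exists, is the infimum of the rationals \<open>q\<close> with \<open>ratio_sum q \<le> 1\<close>. Hence
  existence is a measurable event; this is needed as \<open>M\<close> is not assumed to be complete.\<close>

lemma sets_ex_balance_exponent: "{\<omega> \<in> space M. \<exists>\<sigma>. is_balance_exponent (\<lambda>j. T j \<omega>) \<sigma>} \<in> sets M"
proof -
  \<comment> \<open>An infimum over the countably many rationals is measurable; a rational that
    fails the test is replaced by infinity and so does not count.\<close>
  define X where "X \<omega> = (INF q::rat. if ratio_sum (of_rat q) \<omega> \<le> 1 then ereal (of_rat q) else \<infinity>)" for \<omega>
  have [measurable]: "X \<in> borel_measurable M"
    unfolding X_def by measurable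
  have X: "X \<omega> = ereal \<sigma>" if w: "\<omega> \<in> space M" and 1: "ratio_sum \<sigma> \<omega> = 1" for \<omega> \<sigma>
  proof (rule antisym)
    have eq: "X \<omega> = (INF q::rat. if \<sigma> \<le> of_rat q then ereal (of_rat q) else \<infinity>)"
      unfolding X_def by (simp add: ratio_sum_le_1_iff[OF w 1])
    show "ereal \<sigma> \<le> X \<omega>"
      unfolding eq by (rule INF_greatest) auto
    show "X \<omega> \<le> ereal \<sigma>"
    proof (rule ereal_le_epsilon2)
      fix e :: real assume "e > 0"
      then obtain q where q: "\<sigma> < of_rat q" "of_rat q < \<sigma> + e" using of_rat_dense[of \<sigma> "\<sigma> + e"] by auto
      have "X \<omega> \<le> (if \<sigma> \<le> of_rat q then ereal (of_rat q) else \<infinity>)"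
        unfolding eq by (rule INF_lower) simp
      also have "\<dots> \<le> ereal \<sigma> + ereal e" using q by simp
      finally show "X \<omega> \<le> ereal \<sigma> + ereal e" .
    qed
  qed
  \<comment> \<open>\<open>X\<close> is the only candidate, so existence is tested by inserting it
    back; \<open>real_of_ereal\<close> merely gives the candidate a real value where
    \<open>X\<close> is infinite.\<close>
  have "(\<exists>\<sigma>. is_balance_exponent (\<lambda>j. T j \<omega>) \<sigma>) \<longleftrightarrow>
    real_of_ereal (X \<omega>) > 1 / 2 \<and> ratio_sum (real_of_ereal (X \<omega>)) \<omega> = 1" if w: "\<omega> \<in> space M" for \<omega>
  proof
    assume "\<exists>\<sigma>. is_balance_exponent (\<lambda>j. T j \<omega>) \<sigma>"
    then obtain \<sigma> where \<sigma>: "\<sigma> > 1 / 2" "ratio_sum \<sigma> \<omega> = 1"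
      unfolding is_balance_exponent_ratio_sum_iff[OF w] by blast
    then have "real_of_ereal (X \<omega>) = \<sigma>" using X[OF w \<sigma>(2)] by simp
    then show "real_of_ereal (X \<omega>) > 1 / 2 \<and> ratio_sum (real_of_ereal (X \<omega>)) \<omega> = 1" using \<sigma> by simp
  next
    assume "real_of_ereal (X \<omega>) > 1 / 2 \<and> ratio_sum (real_of_ereal (X \<omega>)) \<omega> = 1"
    then show "\<exists>\<sigma>. is_balance_exponent (\<lambda>j. T j \<omega>) \<sigma>"
      unfolding is_balance_exponent_ratio_sum_iff[OF w] by blast
  qed
  then have "{\<omega> \<in> space M. \<exists>\<sigma>. is_balance_exponent (\<lambda>j. T j \<omega>) \<sigma>} =
    {\<omega> \<in> space M. real_of_ereal (X \<omega>) > 1 / 2 \<and> ratio_sum (real_of_ereal (X \<omega>)) \<omega> = 1}"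
    by blast
  also have "\<dots> \<in> sets M" by measurable
  finally show ?thesis .
qed

text \<open>Where an exponent exists, the event reads \<open>ratio_sum c <= 1\<close>. Elsewhere the
  definite description is one and the same real for every outcome, so the event contains all of that
  remainder or none of it.\<close>

lemma sets_balance_exponent_le: "{\<omega> \<in> space M. balance_exponent (\<lambda>j. T j \<omega>) \<le> c} \<in> sets M"
proof -
  define E where "E = {\<omega> \<in> space M. \<exists>\<sigma>. is_balance_exponent (\<lambda>j. T j \<omega>) \<sigma>}"
  have [measurable]: "E \<in> sets M" unfolding E_def by (rule sets_ex_balance_exponent)
  have in_E: "balance_exponent (\<lambda>j. T j \<omega>) \<le> c \<longleftrightarrow> ratio_sum c \<omega> \<le> 1" if E: "\<omega> \<in> E" for \<omega>
  proof -
    obtain \<sigma> where w: "\<omega> \<in> space M" and \<sigma>: "is_balance_exponent (\<lambda>j. T j \<omega>) \<sigma>"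
      using E by (auto simp: E_def)
    have "ratio_sum \<sigma> \<omega> = 1" using \<sigma> by (simp add: is_balance_exponent_ratio_sum_iff[OF w])
    then show ?thesis using balance_exponent_eq[OF w \<sigma>] ratio_sum_le_1_iff[OF w] by simp
  qed
  have not_E: "balance_exponent (\<lambda>j. T j \<omega>) = (THE \<sigma>. False)" if "\<omega> \<in> space M - E" for \<omega>
    using that by (simp add: E_def balance_exponent_def)
  have "{\<omega> \<in> space M. balance_exponent (\<lambda>j. T j \<omega>) \<le> c}
      = {\<omega> \<in> space M. \<omega> \<in> E \<and> ratio_sum c \<omega> \<le> 1} \<union> {\<omega> \<in> space M. \<omega> \<notin> E \<and> (THE \<sigma>::real. False) \<le> c}"
  proof (rule set_eqI)
    fix \<omega>
    show "\<omega> \<in> {\<omega> \<in> space M. balance_exponent (\<lambda>j. T j \<omega>) \<le> c} \<longleftrightarrow> \<omega> \<in>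
      {\<omega> \<in> space M. \<omega> \<in> E \<and> ratio_sum c \<omega> \<le> 1} \<union> {\<omega> \<in> space M. \<omega> \<notin> E \<and> (THE \<sigma>::real. False) \<le> c}"
      using in_E[of \<omega>] not_E[of \<omega>] by (cases "\<omega> \<in> E") auto
  qed
  also have "\<dots> \<in> sets M" by measurable
  finally show ?thesis .
qed

text \<open>Where an exponent exists and the power sum converges, \<open>ratio_sum c <= 1\<close>
  multiplied by the positive number \<open>T 1 powr - (2 * c)\<close> is the sign condition on the
  gap.\<close>

lemma prob_balance_exponent_le:
  assumes c: "c > 1 / 2"
  shows "prob {\<omega> \<in> space M. balance_exponent (\<lambda>j. T j \<omega>) \<le> c} = prob {\<omega> \<in> space M. gap (2 * c) \<omega> \<le> 0}"
proof (rule finite_measure_eq_AE)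
  have c': "2 * c > 1" using c by simp
  show "AE \<omega> in M. (\<omega> \<in> {\<omega> \<in> space M. balance_exponent (\<lambda>j. T j \<omega>) \<le> c})
      = (\<omega> \<in> {\<omega> \<in> space M. gap (2 * c) \<omega> \<le> 0})"
    using AE_ex_balance_exponent AE_summable_powr[OF c'] AE_space
  proof eventually_elim
    case (elim \<omega>)
    then obtain \<sigma> where \<sigma>: "is_balance_exponent (\<lambda>j. T j \<omega>) \<sigma>" by blast
    have w: "\<omega> \<in> space M" and s: "summable (\<lambda>j. T (Suc j) \<omega> powr - (2 * c))"
      using elim c by auto
    have pos: "T 1 \<omega> powr - (2 * c) > 0" using points_pos[OF w] by simp
    have s2: "summable (\<lambda>j. T (Suc (Suc j)) \<omega> powr - (2 * c))"
      using s by (subst summable_Suc_iff)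
    have eq: "(\<lambda>j. point_ratio j \<omega> powr - (2 * c)) = (\<lambda>j. T (Suc (Suc j)) \<omega> powr - (2 * c) / T 1 \<omega> powr - (2 * c))"
      using point_pos[OF w] by (auto simp: point_ratio_def powr_divide less_imp_le)
    have "balance_exponent (\<lambda>j. T j \<omega>) \<le> c \<longleftrightarrow> ratio_sum c \<omega> \<le> 1"
      using \<sigma> balance_exponent_eq[OF w \<sigma>] ratio_sum_le_1_iff[OF w, of \<sigma> c]
      by (simp add: is_balance_exponent_ratio_sum_iff[OF w])
    also have "\<dots> \<longleftrightarrow> (\<Sum>j. T (Suc (Suc j)) \<omega> powr - (2 * c) / T 1 \<omega> powr - (2 * c)) \<le> 1"
      unfolding ratio_sum_def suminf_ennreal_le_1_iff[OF powr_ge_zero] eq using summable_divide[OF s2] by simp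
    also have "\<dots> \<longleftrightarrow> gap (2 * c) \<omega> \<le> 0"
      using pos by (simp add: suminf_divide[OF s2] gap_def)
    finally show ?case using w by simp
  qed
qed (auto intro: sets_balance_exponent_le)

end

theorem theorem3:
  fixes M :: "'a measure" and T :: "nat \<Rightarrow> 'a \<Rightarrow> real" and c :: real
  assumes "poisson_process M (1 / 2) T"
    and "c > 1 / 2"
  shows "let F = (\<lambda>y::real.
           Im (exp (complex_of_real (pi / (4 * c) - y) * \<i>)
               / lower_gamma (complex_of_real (- 1 / (2 * c))) (- \<i> * complex_of_real y))
           * y powr (- 1 - 1 / (2 * c)))
         in measure M {\<omega> \<in> space M. balance_exponent (\<lambda>j. T j \<omega>) \<le> c}
              = 1 / 2 + 2 * c / pi * (LINT y:{0<..}|lborel. F y)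
            \<and> set_integrable lborel {0<..} F"
proof -
  interpret poisson_process M "1 / 2" T by fact
  have b: "2 * c > 1" using assms(2) by simp
  have e: "pi / (2 * (2 * c)) = pi / (4 * c)" by simp
  note F = integral_full_exponent_substitution[OF b, unfolded e]
  show ?thesis
    unfolding Let_def using F prob_balance_exponent_le[OF assms(2)] prob_gap_le_0[OF b] by simp
qed

end
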